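(* Assume that there exist $\alpha,\beta \in \mathcal{X}$ which are, respectively, a lower and an upper solution (as defined in the context) for the problem $$ -u''(t)=f(t,u(t),u(\tau(t))) \ \text{ for a.a. } t \in I=[0,T], \qquad u(t)=\phi(t) \ \text{ for } t \in [-r,0], \quad u(T)=B, \qquad (P) $$ with $\alpha(t) \le \beta(t)$ for all $t \in [-r,T]$, and put $$[\alpha,\beta]=\{\gamma \in \mathcal{C}([-r,T]) : \alpha(t) \le \gamma(t) \le \beta(t) \text{ for all } t \in [-r,T]\}.$$ Assume, moreover, that the following conditions hold: (1) For each $\gamma \in [\alpha,\beta]$ the composition $t \in I \mapsto f(t,\gamma(t),\gamma(\tau(t)))$ is measurable. (2) There exists $\psi \in L^1(I,[0,\infty))$ such that for a.a. $t \in I$, all $x \in [\alpha(t),\beta(t)]$ and all $y \in [\alpha(\tau(t)),\beta(\tau(t))]$ we have $|f(t,x,y)| \le \psi(t)$. (3) There exist nonnegative functions $L_1,L_2$ on $I$ such that for a.a. $t \in I$ $$ f(t,\overline{x},\overline{y})-f(t,x,y) \ge -L_1(t) (\overline{x}-x) - L_2(t) (\overline{y}-y)$$ whenever $\alpha(t) \le x\le \overline{x} \le \beta(t)$ and $\alpha(\tau(t)) \le y \le \overline{y} \le \beta(\tau(t))$. Moreover: - if $T \ge \frac34$, then $L_1,L_2$ satisfy at least one of: (a) $L_1,L_2 \in L^{\infty}(I)$ and $\|L_1+L_2\|_{\infty} < \frac{1}{T^2}$; (b) $L_1,L_2 \in L^2(I)$ and $\|L_1+L_2\|_2 < \left(\frac{3}{2T^3}\right)^{1/2}$;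 (c) $L_1,L_2 \in L^1(I)$ and $\|L_1+L_2\|_1 < \frac{1}{2T}$; - if $0<T<\frac34$, then $L_1,L_2$ satisfy at least one of: (a) above; (b') $L_1,L_2 \in L^2(I)$ and $\|L_1+L_2\|_2 < \frac{\sqrt2}{T}$; (c) above. Then problem $(P)$ has the extremal solutions in $[\alpha,\beta]$; that is, there exist solutions $u_*,u^*\in\mathcal{X}\cap[\alpha,\beta]$ of $(P)$ such that every solution $u \in \mathcal{X}\cap[\alpha,\beta]$ of $(P)$ satisfies $u_*(t) \le u(t) \le u^*(t)$ for all $t \in [-r,T]$.
   Context: Let $T>0$, $r\ge 0$, $I=[0,T]$, $B \in \mathbb{R}$, let $\phi:[-r,0]\to\mathbb{R}$ be continuous, let $\tau: I \to [-r,T]$ be measurable, and let $f: I\times\mathbb{R}^2\to\mathbb{R}$ be a function (not assumed continuous or monotone). Set $$\mathcal{X}=\{u \in \mathcal{C}([-r,T]) : u_{|I} \in W^{2,1}(I)\}.$$ A solution of $(P)$ is a function $u\in\mathcal{X}$ satisfying the differential equation for almost all $t\in I$ together with $u=\phi$ on $[-r,0]$ and $u(T)=B$. Functions $\alpha, \beta \in \mathcal{X}$ are, respectively, a lower and an upper solution for $(P)$ if the compositions $t \in [0,T] \mapsto f(t,\alpha(t),\alpha(\tau(t)))$ and $t \in [0,T] \mapsto f(t,\beta(t),\beta(\tau(t)))$ are measurable and the following conditions hold: - $-\alpha''(t) \le f(t,\alpha(t),\alpha(\tau(t)))$ for a.a. $t \in [0,T]$; $\alpha(t) \le \phi(t)$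 and $\phi(t)-\alpha(t) \le \phi(0)-\alpha(0)$ for all $t \in [-r,0]$; $\alpha(T) \le B$; - $-\beta''(t) \ge f(t,\beta(t),\beta(\tau(t)))$ for a.a. $t \in [0,T]$; $\beta(t) \ge \phi(t)$ and $\beta(t)-\phi(t) \le \beta(0)-\phi(0)$ for all $t \in [-r,0]$; $\beta(T) \ge B$. $\|\cdot\|_p$ denotes the usual norm of $L^p(I)$ with respect to Lebesgue measure. *)

theory Defs
  imports "HOL-Analysis.Analysis" "HOL-Probability.Essential_Supremum"
begin

definition Lp_space :: "real \<Rightarrow> 'a measure \<Rightarrow> ('a \<Rightarrow> real) set" where
  "Lp_space p M = {g \<in> borel_measurable M. integrable M (\<lambda>t. \<bar>g t\<bar> powr p)}"

definition Lp_norm :: "real \<Rightarrow> 'a measure \<Rightarrow> ('a \<Rightarrow> real) \<Rightarrow> real" where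
  "Lp_norm p M g = (LINT t|M. \<bar>g t\<bar> powr p) powr (1 / p)"

definition Linf_norm :: "'a measure \<Rightarrow> ('a \<Rightarrow> real) \<Rightarrow> ereal" where
  "Linf_norm M g = esssup M (\<lambda>t. ereal \<bar>g t\<bar>)"

definition Linf_space :: "'a measure \<Rightarrow> ('a \<Rightarrow> real) set" where
  "Linf_space M = {g \<in> borel_measurable M. Linf_norm M g < \<infinity>}"

lemma Lp_space_1: "Lp_space 1 M = {g. integrable M g}"
  unfolding Lp_space_def by (auto simp: integrable_abs_iff)

abbreviation Leb :: "real \<Rightarrow> real measure" where
  "Leb T \<equiv> lebesgue_on {0..T}"

text \<open>The test functions \<open>C_c^1\<close> on the open interval \<open>(0, T)\<close>, extended by zero to the real line.\<close>

definition test_functions :: "real \<Rightarrow> (real \<Rightarrow> real) set" where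
  "test_functions T =
    {\<eta>. \<eta> C1_differentiable_on UNIV \<and> compact (closure {t. \<eta> t \<noteq> 0}) \<and>
        closure {t. \<eta> t \<noteq> 0} \<subseteq> {0<..<T}}"

definition has_weak_deriv :: "real \<Rightarrow> (real \<Rightarrow> real) \<Rightarrow> (real \<Rightarrow> real) \<Rightarrow> bool" where
  "has_weak_deriv T u v \<longleftrightarrow>
    u \<in> Lp_space 1 (Leb T) \<and> v \<in> Lp_space 1 (Leb T) \<and>
    (\<forall>\<eta>\<in>test_functions T.
       (LINT t|Leb T. u t * deriv \<eta> t) = - (LINT t|Leb T. v t * \<eta> t))"

text \<open>The weak derivative is determined only almost everywhere; \<open>weak_deriv T u\<close> is an arbitrary
  representative, so its values should only be used in statements holding almost everywhere
  on \<open>[0, T]\<close>.\<close>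

definition weak_deriv :: "real \<Rightarrow> (real \<Rightarrow> real) \<Rightarrow> real \<Rightarrow> real" where
  "weak_deriv T u = (SOME v. has_weak_deriv T u v)"

definition W11 :: "real \<Rightarrow> (real \<Rightarrow> real) set" where
  "W11 T = {u. \<exists>v. has_weak_deriv T u v}"

definition W21 :: "real \<Rightarrow> (real \<Rightarrow> real) set" where
  "W21 T = {u \<in> W11 T. weak_deriv T u \<in> W11 T}"

abbreviation weak_deriv2 :: "real \<Rightarrow> (real \<Rightarrow> real) \<Rightarrow> real \<Rightarrow> real" where
  "weak_deriv2 T u \<equiv> weak_deriv T (weak_deriv T u)"

text \<open>Functions on \<open>[-r, T]\<close> are represented by total functions whose values outside
  \<open>[-r, T]\<close> are irrelevant.\<close>

definition X_space :: "real \<Rightarrow> real \<Rightarrow> (real \<Rightarrow> real) set" where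
  "X_space r T = {u. continuous_on {-r..T} u \<and> u \<in> W21 T}"

definition fun_interval ::
    "real \<Rightarrow> real \<Rightarrow> (real \<Rightarrow> real) \<Rightarrow> (real \<Rightarrow> real) \<Rightarrow> (real \<Rightarrow> real) set" where
  "fun_interval r T \<alpha> \<beta> =
    {\<gamma>. continuous_on {-r..T} \<gamma> \<and> (\<forall>t\<in>{-r..T}. \<alpha> t \<le> \<gamma> t \<and> \<gamma> t \<le> \<beta> t)}"

definition is_solution ::
    "real \<Rightarrow> real \<Rightarrow> (real \<Rightarrow> real) \<Rightarrow> real \<Rightarrow> (real \<Rightarrow> real) \<Rightarrow>
     (real \<Rightarrow> real \<Rightarrow> real \<Rightarrow> real) \<Rightarrow> (real \<Rightarrow> real) \<Rightarrow> bool" where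
  "is_solution r T \<phi> B \<tau> f u \<longleftrightarrow>
    u \<in> X_space r T \<and>
    (AE t in Leb T. - weak_deriv2 T u t = f t (u t) (u (\<tau> t))) \<and>
    (\<forall>t\<in>{-r..0}. u t = \<phi> t) \<and> u T = B"

definition is_lower_solution ::
    "real \<Rightarrow> real \<Rightarrow> (real \<Rightarrow> real) \<Rightarrow> real \<Rightarrow> (real \<Rightarrow> real) \<Rightarrow>
     (real \<Rightarrow> real \<Rightarrow> real \<Rightarrow> real) \<Rightarrow> (real \<Rightarrow> real) \<Rightarrow> bool" where
  "is_lower_solution r T \<phi> B \<tau> f \<alpha> \<longleftrightarrow>
    \<alpha> \<in> X_space r T \<and>
    (\<lambda>t. f t (\<alpha> t) (\<alpha> (\<tau> t))) \<in> borel_measurable (Leb T) \<and>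
    (AE t in Leb T. - weak_deriv2 T \<alpha> t \<le> f t (\<alpha> t) (\<alpha> (\<tau> t))) \<and>
    (\<forall>t\<in>{-r..0}. \<alpha> t \<le> \<phi> t \<and> \<phi> t - \<alpha> t \<le> \<phi> 0 - \<alpha> 0) \<and>
    \<alpha> T \<le> B"

definition is_upper_solution ::
    "real \<Rightarrow> real \<Rightarrow> (real \<Rightarrow> real) \<Rightarrow> real \<Rightarrow> (real \<Rightarrow> real) \<Rightarrow>
     (real \<Rightarrow> real \<Rightarrow> real \<Rightarrow> real) \<Rightarrow> (real \<Rightarrow> real) \<Rightarrow> bool" where
  "is_upper_solution r T \<phi> B \<tau> f \<beta> \<longleftrightarrow>
    \<beta> \<in> X_space r T \<and>
    (\<lambda>t. f t (\<beta> t) (\<beta> (\<tau> t))) \<in> borel_measurable (Leb T) \<and>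
    (AE t in Leb T. - weak_deriv2 T \<beta> t \<ge> f t (\<beta> t) (\<beta> (\<tau> t))) \<and>
    (\<forall>t\<in>{-r..0}. \<beta> t \<ge> \<phi> t \<and> \<beta> t - \<phi> t \<le> \<beta> 0 - \<phi> 0) \<and>
    \<beta> T \<ge> B"

end

theory Submission
  imports Defs
begin

text \<open>
The equation is solved by freezing the nonlinearity. For \<open>\<gamma>\<close> between \<open>\<alpha>\<close> and \<open>\<beta>\<close> let \<open>G \<gamma>\<close> be the
solution of the linear problem
\<open>- u'' + L1 u + L2 (u \<circ> \<tau>) = f(t, \<gamma>, \<gamma> \<circ> \<tau>) + L1 \<gamma> + L2 (\<gamma> \<circ> \<tau>)\<close> with the given history and end value; it
exists by a contraction argument (\<open>linear_delay_problem_solvable\<close>). The solutions of the original problem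
between \<open>\<alpha>\<close> and \<open>\<beta>\<close> are the fixed points of \<open>G\<close>.

The one-sided Lipschitz condition says that the right-hand side increases with \<open>\<gamma>\<close>. So \<open>G\<close> is
increasing, and maps the order interval into itself, as soon as the linear operator obeys a maximum
principle (\<open>maximum_principle\<close>, \<open>delay_comparison\<close>). The latter holds although there is a delay: a
function with negative interior minimum and maximum \<open>M \<ge> 0\<close> satisfies \<open>v'' \<le> (L1 + L2) M\<close>, and starting
with slope zero at the minimum it can then rise by at most \<open>7 / 8 * M\<close>, by the smallness
of \<open>L1 + L2\<close>. All the alternative smallness assumptions are used through a single consequence,
\<open>small_weight\<close>.

Since \<open>f\<close> may be discontinuous, iterating \<open>G\<close> need not lead to a fixed point. Instead, the images
\<open>G \<gamma>\<close> share a modulus of continuity, because their second derivatives are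
dominated by one integrable function. Functions with a common modulus are closed under pointwise infima
and suprema, so the theorem of Knaster and Tarski provides the least and the greatest fixed point
(\<open>least_fixpoint_in_fun_interval\<close>, \<open>greatest_fixpoint_in_fun_interval\<close>).

All this takes place with classical derivatives. The passage from weak derivatives rests on the
lemma of du Bois-Reymond and on integration by parts for indefinite integrals
(\<open>W21_imp_has_second_deriv\<close>, \<open>has_second_deriv_imp_W21\<close>).
\<close>

section \<open>Integrals over subintervals\<close>

lemma integrable_Leb_sub:
  fixes f :: "real \<Rightarrow> real"
  assumes "integrable (Leb T) f" "0 \<le> a" "b \<le> T"
  shows "integrable (lebesgue_on {a..b}) f"
proof -
  have "f absolutely_integrable_on {0..T}"
    using assms(1) by (simp add: absolutely_integrable_on_def set_integrable_def integrable_restrict_space)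
  then have "f absolutely_integrable_on {a..b}"
    by (rule set_integrable_subset) (use assms in auto)
  then show ?thesis by (simp add: set_integrable_def integrable_restrict_space)
qed

lemma integrable_on_Leb_sub:
  fixes f :: "real \<Rightarrow> real"
  assumes "integrable (Leb T) f" "0 \<le> a" "b \<le> T"
  shows "f integrable_on {a..b}"
  using integrable_Leb_sub[OF assms] by (simp add: integrable_on_lebesgue_on)

lemma integral_Leb_indicator:
  fixes f :: "real \<Rightarrow> real"
  assumes "integrable (Leb T) f" "0 \<le> a" "b \<le> T"
  shows "integral {a..b} f = (LINT t|Leb T. indicator {a..b} t * f t)"
proof -
  have sub: "{a..b} \<subseteq> {0..T}" using assms by auto
  have "integral {a..b} f = integral\<^sup>L (lebesgue_on {a..b}) f"
    using lebesgue_integral_eq_integral[OF integrable_Leb_sub[OF assms]] by simp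
  also have "\<dots> = (LINT t|lebesgue. indicator {a..b} t * f t)"
    by (simp add: integral_restrict_space)
  also have "\<dots> = (LINT t|lebesgue. indicator {0..T} t * (indicator {a..b} t * f t))"
    by (intro Bochner_Integration.integral_cong) (use sub in \<open>auto simp: indicator_def\<close>)
  also have "\<dots> = (LINT t|Leb T. indicator {a..b} t * f t)"
    by (simp add: integral_restrict_space)
  finally show ?thesis .
qed

lemma integral_Leb_full:
  fixes f :: "real \<Rightarrow> real"
  assumes "integrable (Leb T) f"
  shows "(LINT t|Leb T. f t) = integral {0..T} f"
  using lebesgue_integral_eq_integral[OF assms] by simp

lemma integral_mono_AE_sub:
  fixes f g :: "real \<Rightarrow> real"
  assumes "integrable (Leb T) f" "integrable (Leb T) g" "AE t in Leb T. f t \<le> g t" "0 \<le> a" "b \<le> T"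
  shows "integral {a..b} f \<le> integral {a..b} g"
proof -
  have s[measurable]: "{a..b} \<in> sets (Leb T)"
    using assms by (auto simp: sets_restrict_space_iff)
  show ?thesis
    unfolding integral_Leb_indicator[OF assms(1,4,5)] integral_Leb_indicator[OF assms(2,4,5)]
  proof (rule integral_mono_AE)
    show "integrable (Leb T) (\<lambda>t. indicator {a..b} t * f t)" "integrable (Leb T) (\<lambda>t. indicator {a..b} t * g t)"
      using integrable_mult_indicator[OF s assms(1)] integrable_mult_indicator[OF s assms(2)] by simp_all
    show "AE x in Leb T. indicator {a..b} x * f x \<le> indicator {a..b} x * g x"
      using assms(3) by eventually_elim (auto simp: indicator_def)
  qed
qed

lemma integral_abs_le_sub:
  fixes f g :: "real \<Rightarrow> real"
  assumes "integrable (Leb T) f" "integrable (Leb T) g" "AE t in Leb T. \<bar>f t\<bar> \<le> g t" "0 \<le> a" "b \<le> T"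
  shows "\<bar>integral {a..b} f\<bar> \<le> integral {a..b} g"
proof -
  have "integral {a..b} f \<le> integral {a..b} g" 
    by (rule integral_mono_AE_sub[OF assms(1,2) _ assms(4,5)]) (use assms(3) in \<open>eventually_elim, auto\<close>)
  moreover have "integral {a..b} (\<lambda>t. - f t) \<le> integral {a..b} g" 
    by (rule integral_mono_AE_sub[OF _ assms(2) _ assms(4,5)]) (use assms(1) in simp, use assms(3) in \<open>eventually_elim, auto\<close>)
  ultimately show ?thesis by simp
qed

text \<open>The half-lines form an intersection-stable generator of the Borel sets, so the hypothesis spreads
to all Borel sets by a Dynkin argument; a Lebesgue set differs from a Borel set by a null set.
This replaces the Lebesgue differentiation theorem when primitives are compared.\<close>

lemma AE_eq_0_if_integrals_0:
  fixes w :: "real \<Rightarrow> real"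
  assumes w: "integrable (Leb T) w" and 0: "\<And>t. t \<in> {0..T} \<Longrightarrow> integral {0..t} w = 0"
  shows "AE t in Leb T. w t = 0"
proof (cases "0 \<le> T")
  case False
  then show ?thesis by (auto intro!: AE_I2)
next
  case T: True
  have borel_sets: "B \<inter> {0..T} \<in> sets (Leb T)" if "B \<in> sets borel" for B
    using that by (simp add: sets_restrict_space_iff)
  have int: "integrable (Leb T) (\<lambda>t. indicator B t * w t)" if "B \<in> sets borel" for B
  proof -
    have "integrable (Leb T) (\<lambda>t. indicator (B \<inter> {0..T}) t *\<^sub>R w t)"
      by (rule integrable_mult_indicator[OF borel_sets[OF that] w])
    then show ?thesis
      by (rule Bochner_Integration.integrable_cong[THEN iffD1, rotated 2]) (auto simp: indicator_def)
  qed
  have tot: "(LINT t|Leb T. w t) = 0"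
    using 0[of T] T by (simp add: integral_Leb_full[OF w])
  have borel0: "(LINT t|Leb T. indicator B t * w t) = 0" if "B \<in> sets borel" for B
  proof -
    have "Int_stable (range (\<lambda>a::real. {..a}))"
      by (auto simp: Int_stable_def)
    moreover have "range (\<lambda>a::real. {..a}) \<subseteq> Pow UNIV" by simp
    moreover have "B \<in> sigma_sets UNIV (range (\<lambda>a::real. {..a}))"
      using that by (simp add: borel_eq_atMost)
    ultimately show ?thesis
    proof (induct rule: sigma_sets_induct_disjoint)
      case (basic A)
      then obtain a where A: "A = {..a}" by auto
      consider "a < 0" | "0 \<le> a" "a \<le> T" | "a > T" by linarith
      then show ?case
      proof cases
        case 1
        then have "(LINT t|Leb T. indicator A t * w t) = (LINT t|Leb T. 0)"
          by (intro Bochner_Integration.integral_cong) (auto simp: A indicator_def)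
        then show ?thesis by simp
      next
        case 2
        then have "(LINT t|Leb T. indicator A t * w t) = (LINT t|Leb T. indicator {0..a} t * w t)"
          by (intro Bochner_Integration.integral_cong) (auto simp: A indicator_def)
        then show ?thesis using 0[of a] 2 by (simp add: integral_Leb_indicator[OF w])
      next
        case 3
        then have "(LINT t|Leb T. indicator A t * w t) = (LINT t|Leb T. w t)"
          by (intro Bochner_Integration.integral_cong) (auto simp: A indicator_def)
        then show ?thesis using tot by simp
      qed
    next
      case empty
      then show ?case by simp
    next
      case (compl A)
      then have A: "A \<in> sets borel" by (simp add: borel_eq_atMost)
      have "(LINT t|Leb T. indicator (UNIV - A) t * w t) = (LINT t|Leb T. w t - indicator A t * w t)"
        by (intro Bochner_Integration.integral_cong) (auto simp: indicator_def)
      also have "\<dots> = 0"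
        using Bochner_Integration.integral_diff[OF w int[OF A]] tot compl by simp
      finally show ?case .
    next
      case (union A)
      then have A: "A i \<in> sets borel" for i by (auto simp: borel_eq_atMost)
      let ?A = "\<lambda>i. A i \<inter> {0..T}"
      have U: "(\<Union>i. A i) \<in> sets borel" using A by auto
      have eq: "(LINT t:(C \<inter> {0..T})|Leb T. w t) = (LINT t|Leb T. indicator C t * w t)" for C
        unfolding set_lebesgue_integral_def
        by (intro Bochner_Integration.integral_cong) (auto simp: indicator_def)
      have "(LINT t:(\<Union>i. ?A i)|Leb T. w t) = (\<Sum>i. (LINT t:(?A i)|Leb T. w t))"
      proof (rule lebesgue_integral_countable_add)
        show "set_integrable (Leb T) (\<Union>i. ?A i) w"
          unfolding set_integrable_def
          by (rule integrable_mult_indicator[OF _ w]) (use borel_sets[OF U] in simp)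
      qed (use borel_sets[OF A] union(1) in \<open>auto simp: disjoint_family_on_def\<close>)
      moreover have "(\<Union>i. ?A i) = (\<Union>i. A i) \<inter> {0..T}" by auto
      ultimately show ?case using union(3) by (simp add: eq)
    qed
  qed
  interpret finite_measure "Leb T" by (rule finite_measure_lebesgue_on) simp
  show ?thesis
  proof (rule density_zero[OF w])
    fix A assume "A \<in> sets (Leb T)"
    then have A: "A \<in> sets lebesgue" "A \<subseteq> {0..T}"
      by (auto simp: sets_restrict_space_iff)
    obtain C N where C: "C \<in> sets borel" "negligible N" "C \<union> N = A"
      using sets_lebesgue_almost_borel[OF A(1)] .
    have "AE t in lebesgue. t \<notin> N"
      using C(2) by (intro AE_not_in) (simp add: negligible_iff_null_sets)
    then have "AE t in Leb T. t \<notin> N"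
      by (auto simp: AE_restrict_space_iff)
    then have "AE t in Leb T. indicator A t *\<^sub>R w t = indicator C t * w t"
      by eventually_elim (use C in \<open>auto simp: indicator_def\<close>)
    moreover have "(\<lambda>t. indicator A t *\<^sub>R w t) \<in> borel_measurable (Leb T)"
      by (rule borel_measurable_integrable[OF integrable_mult_indicator[OF \<open>A \<in> sets (Leb T)\<close> w]])
    ultimately have "(LINT t|Leb T. indicator A t *\<^sub>R w t) = (LINT t|Leb T. indicator C t * w t)"
      using borel_measurable_integrable[OF int[OF C(1)]] by (intro integral_cong_AE)
    then show "set_lebesgue_integral (Leb T) A w = 0"
      using borel0[OF C(1)] by (simp add: set_lebesgue_integral_def)
  qed
qed

section \<open>Test functions and weak derivatives of primitives\<close>

lemma test_functionsD:
  assumes "\<eta> \<in> test_functions T"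
  shows "(\<eta> has_real_derivative deriv \<eta> t) (at t)"
    and "continuous_on UNIV (deriv \<eta>)"
    and "t \<notin> {0<..<T} \<Longrightarrow> \<eta> t = 0"
proof -
  obtain D where D: "\<And>x. (\<eta> has_vector_derivative D x) (at x)" "continuous_on UNIV D"
    using assms by (auto simp: test_functions_def C1_differentiable_on_def)
  then have d: "(\<eta> has_real_derivative D x) (at x)" for x
    by (simp add: has_real_derivative_iff_has_vector_derivative)
  then have "deriv \<eta> x = D x" for x by (rule DERIV_imp_deriv)
  then show "(\<eta> has_real_derivative deriv \<eta> t) (at t)" "continuous_on UNIV (deriv \<eta>)"
    using d D(2) by (simp_all add: continuous_on_cong[of UNIV UNIV "deriv \<eta>" D])
  show "t \<notin> {0<..<T} \<Longrightarrow> \<eta> t = 0"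
    using assms closure_subset[of "{t. \<eta> t \<noteq> 0}"] by (auto simp: test_functions_def)
qed

lemma continuous_imp_integrable_Leb:
  fixes f :: "real \<Rightarrow> real"
  assumes "continuous_on {0..T} f"
  shows "integrable (Leb T) f"
  by (rule continuous_imp_integrable_real[OF assms])

lemma integrable_mult_bounded:
  fixes f m :: "real \<Rightarrow> real"
  assumes f: "integrable (Leb T) f" and m[measurable]: "m \<in> borel_measurable (Leb T)"
    and K: "\<And>t. t \<in> {0..T} \<Longrightarrow> \<bar>m t\<bar> \<le> K"
  shows "integrable (Leb T) (\<lambda>t. f t * m t)"
proof (rule Bochner_Integration.integrable_bound)
  have [measurable]: "f \<in> borel_measurable (Leb T)" using f by auto
  show "(\<lambda>t. f t * m t) \<in> borel_measurable (Leb T)" by measurable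
  show "integrable (Leb T) (\<lambda>t. K * f t)" using f by simp
  show "AE t in Leb T. norm (f t * m t) \<le> norm (K * f t)"
  proof (rule AE_I2)
    fix t assume "t \<in> space (Leb T)"
    then have "\<bar>m t\<bar> \<le> \<bar>K\<bar>" using K[of t] by auto
    then show "norm (f t * m t) \<le> norm (K * f t)"
      by (simp add: abs_mult mult.commute[of "\<bar>f t\<bar>"] mult_right_mono)
  qed
qed

lemma integrable_mult_continuous:
  fixes f g :: "real \<Rightarrow> real"
  assumes f: "integrable (Leb T) f" and g: "continuous_on {0..T} g"
  shows "integrable (Leb T) (\<lambda>t. f t * g t)"
proof -
  have "compact (g ` {0..T})" by (rule compact_continuous_image[OF g]) simp
  then obtain K where "\<And>t. t \<in> {0..T} \<Longrightarrow> \<bar>g t\<bar> \<le> K"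
    using compact_imp_bounded bounded_iff by (metis image_eqI real_norm_def)
  then show ?thesis
    using continuous_imp_integrable_Leb[OF g] by (intro integrable_mult_bounded[OF f]) auto
qed

lemma continuous_on_primitive:
  fixes v :: "real \<Rightarrow> real"
  assumes "integrable (Leb T) v"
  shows "continuous_on {0..T} (\<lambda>t. integral {0..t} v)"
  by (rule indefinite_integral_continuous_1) (use integrable_on_Leb_sub[OF assms] in simp)

text \<open>Integration by parts for a function that is only an indefinite integral: exchange the two
integrations over the triangle \<open>s \<le> t\<close> and use that the test function vanishes at \<open>T\<close>.\<close>

lemma integral_primitive_mult_deriv:
  assumes v: "integrable (Leb T) v" and \<eta>: "\<eta> \<in> test_functions T"
  shows "(LINT t|Leb T. integral {0..t} v * deriv \<eta> t) = - (LINT t|Leb T. v t * \<eta> t)"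
proof -
  interpret finite_measure "Leb T" by (rule finite_measure_lebesgue_on) simp
  interpret pair_sigma_finite "Leb T" "Leb T" ..
  note t = test_functionsD[OF \<eta>]
  have d\<eta>: "integrable (Leb T) (deriv \<eta>)"
    by (rule continuous_imp_integrable_Leb) (rule continuous_on_subset[OF t(2)], simp)
  have [measurable]: "v \<in> borel_measurable (Leb T)" "deriv \<eta> \<in> borel_measurable (Leb T)"
    using v d\<eta> by auto
  have [measurable]: "(\<lambda>t. t) \<in> borel_measurable (Leb T)"
    using id_borel_measurable_lebesgue_on by (simp add: id_def)
  let ?f = "\<lambda>s t. (if s \<le> t then v s * deriv \<eta> t else 0)"
  have meas: "case_prod ?f \<in> borel_measurable (Leb T \<Otimes>\<^sub>M Leb T)"
    by measurable
  have bound: "integrable (Leb T \<Otimes>\<^sub>M Leb T) (\<lambda>(s, t). v s * deriv \<eta> t)"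
  proof (rule Fubini_integrable)
    show "integrable (Leb T) (\<lambda>x. LINT y|Leb T. norm (case (x, y) of (s, t) \<Rightarrow> v s * deriv \<eta> t))"
      using v by (simp add: abs_mult)
    show "AE x in Leb T. integrable (Leb T) (\<lambda>y. case (x, y) of (s, t) \<Rightarrow> v s * deriv \<eta> t)"
      using d\<eta> by simp
  qed measurable
  have int: "integrable (Leb T \<Otimes>\<^sub>M Leb T) (case_prod ?f)"
    by (rule Bochner_Integration.integrable_bound[OF bound meas]) (auto intro!: AE_I2)
  have "(LINT t|Leb T. integral {0..t} v * deriv \<eta> t) = (LINT t|Leb T. LINT s|Leb T. ?f s t)"
  proof (intro Bochner_Integration.integral_cong refl)
    fix t assume "t \<in> space (Leb T)"
    then have "integral {0..t} v = (LINT s|Leb T. indicator {0..t} s * v s)"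
      using integral_Leb_indicator[OF v, of 0 t] by simp
    then have "integral {0..t} v * deriv \<eta> t = (LINT s|Leb T. indicator {0..t} s * v s * deriv \<eta> t)"
      by simp
    also have "\<dots> = (LINT s|Leb T. ?f s t)"
      by (intro Bochner_Integration.integral_cong) (auto simp: indicator_def)
    finally show "integral {0..t} v * deriv \<eta> t = (LINT s|Leb T. ?f s t)" .
  qed
  also have "\<dots> = (LINT s|Leb T. LINT t|Leb T. ?f s t)"
    by (rule Fubini_integral[OF int])
  also have "\<dots> = (LINT s|Leb T. - (v s * \<eta> s))"
  proof (intro Bochner_Integration.integral_cong refl)
    fix s assume "s \<in> space (Leb T)"
    then have s: "0 \<le> s" "s \<le> T" by auto
    have "(LINT t|Leb T. ?f s t) = (LINT t|Leb T. v s * (indicator {s..T} t * deriv \<eta> t))"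
      by (intro Bochner_Integration.integral_cong) (auto simp: indicator_def)
    also have "\<dots> = v s * integral {s..T} (deriv \<eta>)"
      using integral_Leb_indicator[OF d\<eta> s(1)] by simp
    also have "integral {s..T} (deriv \<eta>) = \<eta> T - \<eta> s"
      by (rule integral_unique, rule fundamental_theorem_of_calculus[OF s(2)])
        (use t(1) in \<open>auto simp: has_real_derivative_iff_has_vector_derivative intro: has_vector_derivative_at_within\<close>)
    also have "\<eta> T = 0" using t(3) by simp
    finally show "(LINT t|Leb T. ?f s t) = - (v s * \<eta> s)" by simp
  qed
  finally show ?thesis by simp
qed

lemma primitive_has_weak_deriv:
  assumes T: "0 \<le> T" and v: "integrable (Leb T) v" and u: "\<And>t. t \<in> {0..T} \<Longrightarrow> u t = c + integral {0..t} v"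
  shows "has_weak_deriv T u v"
  unfolding has_weak_deriv_def Lp_space_1
proof (intro conjI ballI CollectI v)
  have P: "integrable (Leb T) (\<lambda>t. integral {0..t} v)"
    by (rule continuous_imp_integrable_Leb[OF continuous_on_primitive[OF v]])
  have "integrable (Leb T) (\<lambda>t. c + integral {0..t} v)"
    by (rule continuous_imp_integrable_Leb) (intro continuous_intros continuous_on_primitive[OF v])
  then show "integrable (Leb T) u"
    using u by (subst Bochner_Integration.integrable_cong[OF refl]) auto
  fix \<eta> assume \<eta>: "\<eta> \<in> test_functions T"
  note t = test_functionsD[OF \<eta>]
  have cd: "continuous_on {0..T} (deriv \<eta>)" by (rule continuous_on_subset[OF t(2)]) simp
  note d\<eta> = continuous_imp_integrable_Leb[OF cd]
  have "integral {0..T} (deriv \<eta>) = \<eta> T - \<eta> 0"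
      by (rule integral_unique, rule fundamental_theorem_of_calculus[OF T])
        (use t(1) in \<open>auto simp: has_real_derivative_iff_has_vector_derivative intro: has_vector_derivative_at_within\<close>)
  then have 0: "(LINT t|Leb T. deriv \<eta> t) = 0" by (simp add: integral_Leb_full[OF d\<eta>] t(3))
  have "(LINT t|Leb T. u t * deriv \<eta> t) = (LINT t|Leb T. c * deriv \<eta> t + integral {0..t} v * deriv \<eta> t)"
    using u by (intro Bochner_Integration.integral_cong) (auto simp: distrib_right)
  also have "\<dots> = (LINT t|Leb T. c * deriv \<eta> t) + (LINT t|Leb T. integral {0..t} v * deriv \<eta> t)"
    by (rule Bochner_Integration.integral_add) (use d\<eta> integrable_mult_continuous[OF P cd] in auto)
  finally show "(LINT t|Leb T. u t * deriv \<eta> t) = - (LINT t|Leb T. v t * \<eta> t)"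
    by (simp add: 0 integral_primitive_mult_deriv[OF v \<eta>])
qed

text \<open>The primitive of \<open>\<zeta>\<close> that vanishes left of \<open>a\<close> also vanishes right of \<open>b\<close>, because \<open>\<zeta>\<close> has mean
zero; thus the derivatives of test functions are precisely the continuous functions of mean zero
with compact support in the open interval.\<close>

lemma test_function_with_deriv:
  fixes \<zeta> :: "real \<Rightarrow> real"
  assumes ab: "0 < a" "a \<le> b" "b < T" and \<zeta>: "continuous_on UNIV \<zeta>"
    and supp: "\<And>t. t \<notin> {a..b} \<Longrightarrow> \<zeta> t = 0" and mean: "integral {0..T} \<zeta> = 0"
  obtains \<eta> where "\<eta> \<in> test_functions T" "deriv \<eta> = \<zeta>"
proof -
  obtain F where F: "\<And>x. (F has_vector_derivative \<zeta> x) (at x)"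
    using einterval_antiderivative[of "-\<infinity>" "\<infinity>" \<zeta>] \<zeta> by (auto simp: continuous_on_eq_continuous_at)
  then have Fr: "(F has_real_derivative \<zeta> x) (at x)" for x
    by (simp add: has_real_derivative_iff_has_vector_derivative)
  define \<eta> where "\<eta> t = F t - F a" for t
  have \<eta>r: "(\<eta> has_real_derivative \<zeta> x) (at x)" for x
    unfolding \<eta>_def by (rule DERIV_cong) (auto intro!: derivative_eq_intros Fr)
  have ftc: "(\<zeta> has_integral (\<eta> y - \<eta> x)) {x..y}" if "x \<le> y" for x y
    by (rule fundamental_theorem_of_calculus[OF that])
      (use \<eta>r in \<open>auto simp: has_real_derivative_iff_has_vector_derivative intro: has_vector_derivative_at_within\<close>)
  have flat: "\<eta> x = \<eta> y" if "x \<le> y" "y \<le> a \<or> b \<le> x" for x y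
  proof -
    have z: "\<zeta> z = 0" if "z \<in> {x<..<y}" for z
      using that \<open>y \<le> a \<or> b \<le> x\<close> by (intro supp) auto
    have "(\<zeta> has_integral 0) (cbox x y)"
      by (rule has_integral_spike_interior[OF has_integral_0]) (rule z, simp only: box_real)
    then have "(\<zeta> has_integral 0) {x..y}" by (simp only: cbox_interval)
    from has_integral_unique[OF this ftc[OF that(1)]] show ?thesis by simp
  qed
  have left: "\<eta> x = 0" if "x < a" for x
    using flat[of x a] that by (auto simp: \<eta>_def)
  have "\<eta> T = \<eta> 0"
    using ftc[of 0 T] mean ab by (auto dest!: integral_unique)
  then have "\<eta> T = 0" using left[of 0] ab by simp
  then have "\<eta> b = 0" using flat[of b T] ab by auto
  then have right: "\<eta> x = 0" if "x > b" for x
    using flat[of b x] that by auto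
  have sub: "{t. \<eta> t \<noteq> 0} \<subseteq> {a..b}" using left right by force
  then have cl: "closure {t. \<eta> t \<noteq> 0} \<subseteq> {a..b}" by (simp add: closure_minimal)
  have "\<eta> C1_differentiable_on UNIV"
    unfolding C1_differentiable_on_def
    using \<eta>r \<zeta> by (auto simp: has_real_derivative_iff_has_vector_derivative)
  moreover have "compact (closure {t. \<eta> t \<noteq> 0})"
    using sub by (meson bounded_closed_interval bounded_subset compact_closure)
  ultimately have "\<eta> \<in> test_functions T"
    using cl ab by (auto simp: test_functions_def)
  moreover have "deriv \<eta> = \<zeta>" using DERIV_imp_deriv[OF \<eta>r] by auto
  ultimately show ?thesis using that by blast
qed

section \<open>The lemma of du Bois-Reymond\<close>

text \<open>Continuous approximations, from inside, of the indicator of the interval between \<open>a\<close> and \<open>b\<close>: slope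
\<open>n\<close> at both ends, height at most one, zero outside.\<close>

definition trapezoid :: "real \<Rightarrow> real \<Rightarrow> nat \<Rightarrow> real \<Rightarrow> real" where
  "trapezoid a b n t = max 0 (min 1 (real n * min (t - a) (b - t)))"

lemma trapezoid_basic:
  "continuous_on S (trapezoid a b n)"
  "t \<notin> {a<..<b} \<Longrightarrow> trapezoid a b n t = 0"
  "0 \<le> trapezoid a b n t" "trapezoid a b n t \<le> 1"
proof -
  show "continuous_on S (trapezoid a b n)"
    unfolding trapezoid_def by (intro continuous_intros)
  show "trapezoid a b n t = 0" if "t \<notin> {a<..<b}"
  proof -
    have "min (t - a) (b - t) \<le> 0" using that by auto
    then have "real n * min (t - a) (b - t) \<le> 0" by (simp add: mult_nonneg_nonpos)
    then show ?thesis unfolding trapezoid_def by linarith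
  qed
qed (auto simp: trapezoid_def)

lemma trapezoid_tendsto: "(\<lambda>n. trapezoid a b n t) \<longlonglongrightarrow> indicator {a<..<b} t"
proof (cases "t \<in> {a<..<b}")
  case True
  define d where "d = min (t - a) (b - t)"
  have d: "d > 0" using True by (simp add: d_def)
  obtain N :: nat where N: "real N > 1 / d" using reals_Archimedean2 by blast
  have "trapezoid a b n t = 1" if "n \<ge> N" for n
  proof -
    have "1 < real N * d" using N d by (simp add: field_simps)
    also have "\<dots> \<le> real n * d" using that d by (simp add: mult_right_mono)
    finally show ?thesis by (simp add: trapezoid_def d_def)
  qed
  then have "\<forall>\<^sub>F n in sequentially. trapezoid a b n t = 1"
    by (auto simp: eventually_sequentially)
  then show ?thesis using True by (simp add: tendsto_eventually)
next
  case False
  then have "trapezoid a b n t = 0" for n by (rule trapezoid_basic(2))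
  then show ?thesis using False by (simp)
qed

lemma integral_mult_trapezoid_tendsto:
  fixes w :: "real \<Rightarrow> real"
  assumes w: "integrable (Leb T) w" and ab: "0 \<le> a" "b \<le> T"
  shows "(\<lambda>n. LINT t|Leb T. w t * trapezoid a b n t) \<longlonglongrightarrow> integral {a..b} w"
proof -
  have [measurable]: "w \<in> borel_measurable (Leb T)" "trapezoid a b n \<in> borel_measurable (Leb T)" for n
    using w continuous_imp_integrable_Leb[OF trapezoid_basic(1)[of _ a b n]] by auto
  have [measurable]: "indicator {a<..<b} \<in> borel_measurable (Leb T)"
    using ab by (intro borel_measurable_indicator) (auto simp: sets_restrict_space_iff)
  have "(\<lambda>n. LINT t|Leb T. w t * trapezoid a b n t) \<longlonglongrightarrow> (LINT t|Leb T. w t * indicator {a<..<b} t)"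
  proof (rule integral_dominated_convergence[where w = "\<lambda>t. \<bar>w t\<bar>"])
    show "AE t in Leb T. (\<lambda>n. w t * trapezoid a b n t) \<longlonglongrightarrow> w t * indicator {a<..<b} t"
      by (intro AE_I2 tendsto_intros trapezoid_tendsto)
    show "AE t in Leb T. norm (w t * trapezoid a b n t) \<le> \<bar>w t\<bar>" for n
      using trapezoid_basic(3,4)[of a b n] by (intro AE_I2) (simp add: abs_mult mult_left_le)
  qed (use w in auto)
  moreover have "(LINT t|Leb T. w t * indicator {a<..<b} t) = (LINT t|Leb T. indicator {a..b} t * w t)"
  proof (rule integral_cong_AE)
    have "{a, b} \<in> null_sets lebesgue" by (simp flip: negligible_iff_null_sets)
    then have "AE t in lebesgue. t \<notin> {a, b}" using AE_not_in by blast
    then have "AE t in Leb T. t \<notin> {a, b}" by (auto simp: AE_restrict_space_iff)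
    then show "AE t in Leb T. w t * indicator {a<..<b} t = indicator {a..b} t * w t"
      by eventually_elim (auto simp: indicator_def)
    have [measurable]: "indicator {a..b} \<in> borel_measurable (Leb T)"
      using ab by (intro borel_measurable_indicator) (auto simp: sets_restrict_space_iff)
    show "(\<lambda>t. indicator {a..b} t * w t) \<in> borel_measurable (Leb T)" by measurable
  qed measurable
  ultimately show ?thesis using integral_Leb_indicator[OF w ab] by simp
qed

text \<open>The lemma of du Bois-Reymond. Given two intervals, a linear combination of their trapezoids has
mean zero, hence is the derivative of a test function and is annihilated by \<open>w\<close>. In the limit the
integrals of \<open>w\<close> over the two intervals are proportional to their lengths, so that the primitive
of \<open>w\<close> is affine.\<close>

lemma du_Bois_Reymond:
  fixes w :: "real \<Rightarrow> real"
  assumes T: "0 < T" and w: "integrable (Leb T) w"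
    and orth: "\<And>\<eta>. \<eta> \<in> test_functions T \<Longrightarrow> (LINT t|Leb T. w t * deriv \<eta> t) = 0"
  obtains k where "AE t in Leb T. w t = k"
proof -
  have one: "integrable (Leb T) (\<lambda>t. 1::real)" by (rule continuous_imp_integrable_Leb) simp
  have proportional: "(d - c) * integral {a..b} w = (b - a) * integral {c..d} w"
    if ab: "0 < a" "a \<le> b" "b < T" and cd: "0 < c" "c \<le> d" "d < T" for a b c d
  proof -
    define m where "m a b n = integral {0..T} (trapezoid a b n)" for a b n
    define W where "W a b n = (LINT t|Leb T. w t * trapezoid a b n t)" for a b n
    have int: "integrable (Leb T) (trapezoid a b n)" for a b n
      by (rule continuous_imp_integrable_Leb[OF trapezoid_basic(1)])
    have intw: "integrable (Leb T) (\<lambda>t. w t * trapezoid a b n t)" for a b n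
      by (rule integrable_mult_continuous[OF w trapezoid_basic(1)])
    have "m c d n * W a b n = m a b n * W c d n" for n
    proof -
      let ?\<zeta> = "\<lambda>t. m c d n * trapezoid a b n t - m a b n * trapezoid c d n t"
      have mean: "integral {0..T} ?\<zeta> = 0"
        using integrable_on_Leb_sub[OF int, of 0 T] by (simp add: integral_diff integrable_on_mult_right m_def)
      have supp: "?\<zeta> t = 0" if "t \<notin> {min a c..max b d}" for t
      proof -
        have "t \<notin> {a<..<b}" "t \<notin> {c<..<d}"
          using that by (auto simp: min_le_iff_disj le_max_iff_disj)
        then show ?thesis by (simp add: trapezoid_basic(2))
      qed
      have cont: "continuous_on UNIV ?\<zeta>"
        by (intro continuous_intros trapezoid_basic)
      have lim: "0 < min a c" "min a c \<le> max b d" "max b d < T"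
        using ab cd by auto
      obtain \<eta> where "\<eta> \<in> test_functions T" "deriv \<eta> = ?\<zeta>"
        by (rule test_function_with_deriv[OF lim cont supp mean])
      then have "0 = (LINT t|Leb T. w t * ?\<zeta> t)" using orth by metis
      also have "\<dots> = (LINT t|Leb T. m c d n * (w t * trapezoid a b n t) - m a b n * (w t * trapezoid c d n t))"
        by (simp add: algebra_simps)
      also have "\<dots> = m c d n * W a b n - m a b n * W c d n"
        unfolding W_def using intw by simp
      finally show ?thesis by simp
    qed
    moreover have W: "W a b \<longlonglongrightarrow> integral {a..b} w" if "0 < a" "b < T" for a b
      unfolding W_def using integral_mult_trapezoid_tendsto[OF w, of a b] that by simp
    moreover have m: "m a b \<longlonglongrightarrow> b - a" if "0 < a" "a \<le> b" "b < T" for a b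
      using integral_mult_trapezoid_tendsto[OF one, of a b] that integral_Leb_full[OF int] 
      unfolding m_def by simp
    ultimately show ?thesis
      using LIMSEQ_unique[OF tendsto_mult[OF m[OF cd] W[OF ab(1,3)]]] 
         tendsto_mult[OF m[OF ab] W[OF cd(1,3)]] by simp
  qed
  \<comment> \<open>The middle third serves as reference interval.\<close>
  define k where "k = integral {T/3..2*T/3} w / (T/3)"
  have inner: "integral {a..b} w = (b - a) * k" if "0 < a" "a \<le> b" "b < T" for a b
    using proportional[OF that, of "T/3" "2*T/3"] T by (simp add: k_def field_simps)
  define P where "P t = integral {0..t} w" for t
  have P: "continuous_on {0..T} P"
    unfolding P_def by (rule continuous_on_primitive[OF w])
  have int: "w integrable_on {0..t}" if "t \<le> T" for t
    using integrable_on_Leb_sub[OF w _ that, of 0] by simp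
  have incr: "P b - P a = (b - a) * k" if "0 < a" "a \<le> b" "b < T" for a b
    using Henstock_Kurzweil_Integration.integral_combine[of 0 a b w] int[of b] inner[OF that] that by (simp add: P_def)
  define D where "D t = P t - t * k - (P (T/2) - (T/2) * k)" for t
  have "continuous_on {0..T} D" unfolding D_def by (intro continuous_intros P)
  moreover have "D t = 0" if "t \<in> {0<..<T}" for t
  proof (cases "t \<le> T/2")
    case True then show ?thesis using incr[of t "T/2"] that T by (simp add: D_def algebra_simps)
  next
    case False then show ?thesis using incr[of "T/2" t] that T by (simp add: D_def algebra_simps)
  qed
  ultimately have D: "D t = 0" if "t \<in> {0..T}" for t
    using continuous_constant_on_closure[of "{0<..<T}" D 0 t] that T by (simp)
  have "AE t in Leb T. w t - k = 0"
  proof (rule AE_eq_0_if_integrals_0)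
    show "integrable (Leb T) (\<lambda>t. w t - k)" using w continuous_imp_integrable_Leb[of T "\<lambda>_. k"] by simp
    fix t assume t: "t \<in> {0..T}"
    have "P 0 = 0" by (simp add: P_def)
    then have "P t = t * k" using D[OF t] D[of 0] T by (simp add: D_def)
    then show "integral {0..t} (\<lambda>t. w t - k) = 0"
      using int[of t] t by (simp add: Henstock_Kurzweil_Integration.integral_diff integrable_const_ivl P_def)
  qed
  then show ?thesis using that[of k] by simp
qed

section \<open>Weak second derivatives as classical ones\<close>

lemma AE_eq_continuous_imp_eq:
  fixes f g :: "real \<Rightarrow> real"
  assumes T: "0 < T" and f: "continuous_on {0..T} f" and g: "continuous_on {0..T} g"
    and AE: "AE t in Leb T. f t = g t" and t: "t \<in> {0..T}"
  shows "f t = g t"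
proof -
  have c: "continuous_on {0..T} (\<lambda>t. \<bar>f t - g t\<bar>)" by (intro continuous_intros f g)
  have "(LINT t|Leb T. \<bar>f t - g t\<bar>) = 0"
    by (rule integral_eq_zero_AE) (use AE in eventually_elim, simp)
  then have "integral {0..T} (\<lambda>t. \<bar>f t - g t\<bar>) = 0"
    by (simp add: integral_Leb_full[OF continuous_imp_integrable_Leb[OF c]])
  then show ?thesis using integral_eq_0_iff[OF c T] t by auto
qed

lemma has_weak_derivD:
  assumes "has_weak_deriv T u v"
  shows "integrable (Leb T) u" "integrable (Leb T) v"
    "\<eta> \<in> test_functions T \<Longrightarrow> (LINT t|Leb T. u t * deriv \<eta> t) = - (LINT t|Leb T. v t * \<eta> t)"
  using assms unfolding has_weak_deriv_def Lp_space_1 by auto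

text \<open>The primitive of \<open>v\<close> has the weak derivative \<open>v\<close> as well, so its difference from \<open>u\<close> is orthogonal to
the derivatives of all test functions.\<close>

lemma has_weak_deriv_imp_primitive:
  assumes T: "0 < T" and uv: "has_weak_deriv T u v"
  obtains c where "AE t in Leb T. u t = c + integral {0..t} v"
proof -
  note D = has_weak_derivD[OF uv]
  define V where "V t = integral {0..t} v" for t
  have V: "has_weak_deriv T V v"
    by (rule primitive_has_weak_deriv[where c = 0]) (use T D in \<open>auto simp: V_def\<close>)
  note DV = has_weak_derivD[OF V]
  have "(LINT t|Leb T. (u t - V t) * deriv \<eta> t) = 0" if \<eta>: "\<eta> \<in> test_functions T" for \<eta>
  proof -
    have c: "continuous_on {0..T} (deriv \<eta>)"
      by (rule continuous_on_subset[OF test_functionsD(2)[OF \<eta>]]) simp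
    have "(LINT t|Leb T. (u t - V t) * deriv \<eta> t)
        = (LINT t|Leb T. u t * deriv \<eta> t) - (LINT t|Leb T. V t * deriv \<eta> t)"
      using integrable_mult_continuous[OF D(1) c] integrable_mult_continuous[OF DV(1) c]
      by (simp add: left_diff_distrib)
    then show ?thesis using D(3)[OF \<eta>] DV(3)[OF \<eta>] by simp
  qed
  with T obtain k where k: "AE t in Leb T. u t - V t = k"
    using du_Bois_Reymond[of T "\<lambda>t. u t - V t"] D(1) DV(1) by auto
  show ?thesis
    by (rule that[of k]) (use k in eventually_elim, simp add: V_def)
qed

lemma has_weak_deriv_unique:
  assumes T: "0 < T" and v: "has_weak_deriv T u v" and v': "has_weak_deriv T u v'"
  shows "AE t in Leb T. v t = v' t"
proof -
  note i = has_weak_derivD(2)[OF v] has_weak_derivD(2)[OF v']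
  obtain c where c: "AE t in Leb T. u t = c + integral {0..t} v"
    using has_weak_deriv_imp_primitive[OF T v] .
  obtain c' where c': "AE t in Leb T. u t = c' + integral {0..t} v'"
    using has_weak_deriv_imp_primitive[OF T v'] .
  have eq: "c + integral {0..t} v = c' + integral {0..t} v'" if "t \<in> {0..T}" for t
  proof (rule AE_eq_continuous_imp_eq[OF T _ _ _ that])
    show "continuous_on {0..T} (\<lambda>t. c + integral {0..t} v)"
      "continuous_on {0..T} (\<lambda>t. c' + integral {0..t} v')"
      by (intro continuous_intros continuous_on_primitive i)+
    show "AE t in Leb T. c + integral {0..t} v = c' + integral {0..t} v'"
      using c c' by eventually_elim simp
  qed
  have "AE t in Leb T. v t - v' t = 0"
  proof (rule AE_eq_0_if_integrals_0)
    show "integrable (Leb T) (\<lambda>t. v t - v' t)" using i by simp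
    fix t assume t: "t \<in> {0..T}"
    have "c = c'" using eq[of 0] T by simp
    then show "integral {0..t} (\<lambda>t. v t - v' t) = 0"
      using eq[OF t] integrable_on_Leb_sub[OF i(1), of 0 t] integrable_on_Leb_sub[OF i(2), of 0 t] t
      by (simp add: Henstock_Kurzweil_Integration.integral_diff)
  qed
  then show ?thesis by simp
qed

lemma has_weak_deriv_weak_deriv:
  assumes "u \<in> W11 T"
  shows "has_weak_deriv T u (weak_deriv T u)"
  using assms someI_ex[of "has_weak_deriv T u"] by (auto simp: W11_def weak_deriv_def)

text \<open>The classical description of \<open>W21\<close> used from here on: \<open>u\<close> has everywhere the derivative \<open>p\<close>, and \<open>p\<close> is
the indefinite integral of \<open>g\<close>. The derivative \<open>p\<close> is carried along since its values at single
points matter below.\<close>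

definition has_second_deriv :: "real \<Rightarrow> (real \<Rightarrow> real) \<Rightarrow> (real \<Rightarrow> real) \<Rightarrow> (real \<Rightarrow> real) \<Rightarrow> bool" where
  "has_second_deriv T u p g \<longleftrightarrow> integrable (Leb T) g \<and>
    (\<forall>t\<in>{0..T}. p t = p 0 + integral {0..t} g) \<and>
    (\<forall>t\<in>{0..T}. (u has_real_derivative p t) (at t within {0..T}))"

lemma has_second_derivD:
  assumes "has_second_deriv T u p g"
  shows "integrable (Leb T) g"
    and "t \<in> {0..T} \<Longrightarrow> p t = p 0 + integral {0..t} g"
    and "t \<in> {0..T} \<Longrightarrow> (u has_real_derivative p t) (at t within {0..T})"
    and "continuous_on {0..T} p" and "continuous_on {0..T} u"
proof -
  show g: "integrable (Leb T) g"
    and p: "\<And>t. t \<in> {0..T} \<Longrightarrow> p t = p 0 + integral {0..t} g"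
    and d: "\<And>t. t \<in> {0..T} \<Longrightarrow> (u has_real_derivative p t) (at t within {0..T})"
    using assms unfolding has_second_deriv_def by blast+
  have "continuous_on {0..T} (\<lambda>t. p 0 + integral {0..t} g)"
    by (intro continuous_intros continuous_on_primitive g)
  then show "continuous_on {0..T} p"
    by (rule continuous_on_eq) (rule p[symmetric])
  show "continuous_on {0..T} u"
    using d by (meson DERIV_continuous continuous_on_eq_continuous_within)
qed

lemma has_second_deriv_diff:
  assumes 1: "has_second_deriv T u p g" and 2: "has_second_deriv T u' p' g'"
  shows "has_second_deriv T (\<lambda>t. u t - u' t) (\<lambda>t. p t - p' t) (\<lambda>t. g t - g' t)"
  unfolding has_second_deriv_def
proof (intro conjI ballI)
  note D = has_second_derivD[OF 1] and D' = has_second_derivD[OF 2]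
  show "integrable (Leb T) (\<lambda>t. g t - g' t)" using D(1) D'(1) by simp
  fix t assume t: "t \<in> {0..T}"
  show "((\<lambda>t. u t - u' t) has_real_derivative p t - p' t) (at t within {0..T})"
    by (intro derivative_intros D(3) D'(3) t)
  show "p t - p' t = p 0 - p' 0 + integral {0..t} (\<lambda>t. g t - g' t)"
    using D(2)[OF t] D'(2)[OF t] integrable_on_Leb_sub[OF D(1), of 0 t] integrable_on_Leb_sub[OF D'(1), of 0 t] t
    by (simp add: Henstock_Kurzweil_Integration.integral_diff)
qed

lemma has_second_deriv_increment:
  assumes 1: "has_second_deriv T u p g" and ab: "0 \<le> a" "a \<le> b" "b \<le> T"
  shows "p b - p a = integral {a..b} g" "u b - u a = integral {a..b} p"
proof -
  note D = has_second_derivD[OF 1]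
  show "p b - p a = integral {a..b} g"
  proof -
    have "integral {0..a} g + integral {a..b} g = integral {0..b} g"
      by (rule Henstock_Kurzweil_Integration.integral_combine)
        (use ab integrable_on_Leb_sub[OF D(1), of 0 b] in simp_all)
    moreover have "p a = p 0 + integral {0..a} g" "p b = p 0 + integral {0..b} g"
      by (rule D(2), use ab in simp)+
    ultimately show ?thesis by linarith
  qed
  have "(p has_integral (u b - u a)) {a..b}"
  proof (rule fundamental_theorem_of_calculus[OF ab(2)])
    fix x assume "x \<in> {a..b}"
    then have "(u has_real_derivative p x) (at x within {a..b})"
      using ab by (intro DERIV_subset[OF D(3)]) auto
    then show "(u has_vector_derivative p x) (at x within {a..b})"
      by (simp only: has_real_derivative_iff_has_vector_derivative)
  qed
  then show "u b - u a = integral {a..b} p" by (simp add: integral_unique)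
qed

text \<open>The arbitrary representatives chosen by \<open>weak_deriv\<close> are harmless: the first derivative is replaced by
its continuous representative, and \<open>u\<close> itself is continuous.\<close>

lemma W21_imp_has_second_deriv:
  assumes T: "0 < T" and u: "u \<in> W21 T" "continuous_on {0..T} u"
  obtains p where "has_second_deriv T u p (weak_deriv2 T u)"
proof -
  let ?v = "weak_deriv T u" and ?g = "weak_deriv2 T u"
  have v: "has_weak_deriv T u ?v" and g: "has_weak_deriv T ?v ?g"
    using u by (auto simp: W21_def intro: has_weak_deriv_weak_deriv)
  note iv = has_weak_derivD(2)[OF v] and ig = has_weak_derivD(2)[OF g]
  obtain c where c: "AE t in Leb T. ?v t = c + integral {0..t} ?g"
    using has_weak_deriv_imp_primitive[OF T g] .
  obtain d where d: "AE t in Leb T. u t = d + integral {0..t} ?v"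
    using has_weak_deriv_imp_primitive[OF T v] .
  define p where "p t = c + integral {0..t} ?g" for t
  have p: "continuous_on {0..T} p"
    unfolding p_def by (intro continuous_intros continuous_on_primitive ig)
  note ip = continuous_imp_integrable_Leb[OF p]
  have vp: "AE t in Leb T. ?v t = p t" using c by (simp add: p_def)
  have "integral {0..t} ?v = integral {0..t} p" if "t \<in> {0..T}" for t
    by (intro antisym integral_mono_AE_sub[OF iv ip] integral_mono_AE_sub[OF ip iv])
      (use that vp in \<open>auto elim: eventually_mono\<close>)
  moreover have "u t = d + integral {0..t} ?v" if "t \<in> {0..T}" for t
    by (rule AE_eq_continuous_imp_eq[OF T u(2) _ d that])
      (intro continuous_intros continuous_on_primitive iv)
  ultimately have up: "d + integral {0..t} p = u t" if "t \<in> {0..T}" for t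
    using that by simp
  have "has_second_deriv T u p ?g"
    unfolding has_second_deriv_def
  proof (intro conjI ballI ig)
    fix t assume t: "t \<in> {0..T}"
    show "p t = p 0 + integral {0..t} ?g" by (simp add: p_def)
    have "((\<lambda>t. d + integral {0..t} p) has_real_derivative p t) (at t within {0..T})"
      using integral_has_real_derivative[OF p t] by (auto intro!: derivative_eq_intros)
    then show "(u has_real_derivative p t) (at t within {0..T})"
      by (rule has_field_derivative_transform_within[where d = 1]) (use up t in auto)
  qed
  then show ?thesis by (rule that)
qed

lemma has_second_deriv_imp_W21:
  assumes T: "0 < T" and u: "has_second_deriv T u p g"
  shows "u \<in> W21 T" and "AE t in Leb T. weak_deriv2 T u t = g t"
proof -
  note D = has_second_derivD[OF u]
  have "has_weak_deriv T u p"
  proof (rule primitive_has_weak_deriv)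
    show "u t = u 0 + integral {0..t} p" if "t \<in> {0..T}" for t
      using has_second_deriv_increment(2)[OF u, of 0 t] that by simp
  qed (use T continuous_imp_integrable_Leb[OF D(4)] in auto)
  then have u1: "u \<in> W11 T" by (auto simp: W11_def)
  have p: "has_weak_deriv T p g"
    by (rule primitive_has_weak_deriv[OF _ D(1) D(2)]) (use T in auto)
  note w = has_weak_deriv_weak_deriv[OF u1]
  have wp: "AE t in Leb T. weak_deriv T u t = p t"
    by (rule has_weak_deriv_unique[OF T w]) fact
  have "has_weak_deriv T (weak_deriv T u) g"
    unfolding has_weak_deriv_def Lp_space_1
  proof (intro conjI ballI CollectI D(1) has_weak_derivD(2)[OF w])
    fix \<eta> assume \<eta>: "\<eta> \<in> test_functions T"
    have c: "continuous_on {0..T} (deriv \<eta>)"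
      by (rule continuous_on_subset[OF test_functionsD(2)[OF \<eta>]]) simp
    have "(LINT t|Leb T. weak_deriv T u t * deriv \<eta> t) = (LINT t|Leb T. p t * deriv \<eta> t)"
    proof (rule integral_cong_AE)
      show "AE t in Leb T. weak_deriv T u t * deriv \<eta> t = p t * deriv \<eta> t"
        using wp by eventually_elim simp
    qed (use integrable_mult_continuous[OF has_weak_derivD(2)[OF w] c]
        integrable_mult_continuous[OF has_weak_derivD(1)[OF p] c] in auto)
    then show "(LINT t|Leb T. weak_deriv T u t * deriv \<eta> t) = - (LINT t|Leb T. g t * \<eta> t)"
      using has_weak_derivD(3)[OF p \<eta>] by simp
  qed
  then have g: "weak_deriv T u \<in> W11 T" and wg: "has_weak_deriv T (weak_deriv T u) g"
    by (auto simp: W11_def)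
  show "u \<in> W21 T" using u1 g by (simp add: W21_def)
  show "AE t in Leb T. weak_deriv2 T u t = g t"
    by (rule has_weak_deriv_unique[OF T has_weak_deriv_weak_deriv[OF g] wg])
qed

section \<open>The maximum principle\<close>

lemma has_integral_affine:
  fixes A C :: real
  assumes "a \<le> b"
  shows "((\<lambda>s. A + C * (s - a)) has_integral (A * (b - a) + C * (b - a)\<^sup>2 / 2)) {a..b}"
    and "((\<lambda>s. A + C * (b - s)) has_integral (A * (b - a) + C * (b - a)\<^sup>2 / 2)) {a..b}"
proof -
  have "((\<lambda>s. A + C * (s - a)) has_integral
      (A * (b - a) + C * (b - a)\<^sup>2 / 2 - (A * (a - a) + C * (a - a)\<^sup>2 / 2))) {a..b}"
  proof (rule fundamental_theorem_of_calculus[OF assms])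
    fix x
    have "((\<lambda>s. A * (s - a) + C * (s - a)\<^sup>2 / 2) has_real_derivative (A + C * (x - a))) (at x within {a..b})"
      by (auto intro!: derivative_eq_intros simp: field_simps)
    then show "((\<lambda>s. A * (s - a) + C * (s - a)\<^sup>2 / 2) has_vector_derivative (A + C * (x - a))) (at x within {a..b})"
      by (simp only: has_real_derivative_iff_has_vector_derivative)
  qed
  then show "((\<lambda>s. A + C * (s - a)) has_integral (A * (b - a) + C * (b - a)\<^sup>2 / 2)) {a..b}"
    by simp
  have "((\<lambda>s. A + C * (b - s)) has_integral
      (- (A * (b - b) + C * (b - b)\<^sup>2 / 2) - - (A * (b - a) + C * (b - a)\<^sup>2 / 2))) {a..b}"
  proof (rule fundamental_theorem_of_calculus[OF assms])
    fix x
    have "((\<lambda>s. - (A * (b - s) + C * (b - s)\<^sup>2 / 2)) has_real_derivative (A + C * (b - x))) (at x within {a..b})"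
      by (auto intro!: derivative_eq_intros simp: field_simps)
    then show "((\<lambda>s. - (A * (b - s) + C * (b - s)\<^sup>2 / 2)) has_vector_derivative (A + C * (b - x))) (at x within {a..b})"
      by (simp only: has_real_derivative_iff_has_vector_derivative)
  qed
  then show "((\<lambda>s. A + C * (b - s)) has_integral (A * (b - a) + C * (b - a)\<^sup>2 / 2)) {a..b}"
    by (simp add: add.commute)
qed

text \<open>The common content of the three integrability alternatives for \<open>L = L1 + L2\<close>. Writing
\<open>x = (b - a) / T\<close>, a bound \<open>1 / T\<^sup>2\<close> on \<open>L\<close> gives \<open>T\<close> times the integral at most \<open>x\<close>, the quadratic bound
gives \<open>sqrt (3 x / 2)\<close>, the integral bound gives \<open>1 / 2\<close>; all three lie below the line
\<open>1 / 2 + 3 x / 4\<close>, whose integral over the unit interval is \<open>7 / 8 < 1\<close>. This last inequality is what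
the maximum principle needs.\<close>

definition small_weight :: "real \<Rightarrow> (real \<Rightarrow> real) \<Rightarrow> bool" where
  "small_weight T L \<longleftrightarrow> integrable (Leb T) L \<and>
    (\<forall>a b. 0 \<le> a \<longrightarrow> a \<le> b \<longrightarrow> b \<le> T \<longrightarrow> integral {a..b} L \<le> 1 / (2 * T) + 3 / (4 * T\<^sup>2) * (b - a))"

lemma small_weight_total:
  assumes "0 < T" "small_weight T L"
  shows "integral {0..T} L \<le> 5 / (4 * T)"
proof -
  have "integral {0..T} L \<le> 1 / (2 * T) + 3 / (4 * T\<^sup>2) * (T - 0)"
    using assms unfolding small_weight_def by (metis order_refl less_imp_le)
  also have "\<dots> = 5 / (4 * T)" using assms(1) by (simp add: field_simps power2_eq_square)
  finally show ?thesis .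
qed

text \<open>The affine majorant in \<open>small_weight\<close>, multiplied by \<open>M\<close> and integrated over an interval of length \<open>x\<close>.\<close>

lemma affine_excursion_bound:
  fixes T M x :: real
  assumes "0 < T" "0 \<le> M" "0 \<le> x" "x \<le> T"
  shows "M * (1 / (2 * T)) * x + M * (3 / (4 * T\<^sup>2)) * x\<^sup>2 / 2 \<le> 7 / 8 * M"
proof -
  have y: "x / T \<le> 1" "0 \<le> x / T" using assms by auto
  have "M * (1 / (2 * T)) * x + M * (3 / (4 * T\<^sup>2)) * x\<^sup>2 / 2 = M * ((x / T) / 2 + 3 / 8 * (x / T)\<^sup>2)"
    by (simp add: power_divide algebra_simps)
  also have "\<dots> \<le> M * (1 / 2 + 3 / 8 * 1)"
    using y assms(2) by (intro mult_left_mono add_mono) (auto simp: power_le_one)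
  finally show ?thesis by simp
qed

text \<open>Suppose that \<open>v\<close> is negative somewhere. Then \<open>v\<close> has a negative minimum at an interior point \<open>m\<close>,
where \<open>v\<close> has derivative zero. Let \<open>v\<close> attain its maximum \<open>M \<ge> 0\<close> at \<open>x\<close>. Between \<open>m\<close> and \<open>x\<close> the
derivative of \<open>v\<close> is the integral of \<open>g \<le> M L\<close> starting at \<open>m\<close>, so \<open>small_weight\<close>
allows \<open>v\<close> to climb by at most \<open>7 / 8 * M\<close> from \<open>m\<close> to \<open>x\<close>. This is less than the climb from a
negative value to \<open>M\<close>. Only an upper bound of \<open>g\<close> in terms of the maximum of \<open>v\<close> enters, which is why a
delayed argument does no harm.\<close>

lemma maximum_principle:
  assumes T: "0 < T" and v: "has_second_deriv T v p g" and bd: "0 \<le> v 0" "0 \<le> v T"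
    and L: "small_weight T L"
    and ineq: "\<And>M. (\<And>t. t \<in> {0..T} \<Longrightarrow> v t \<le> M) \<Longrightarrow> AE t in Leb T. g t \<le> M * L t"
    and t: "t \<in> {0..T}"
  shows "0 \<le> v t"
proof (rule ccontr)
  assume neg: "\<not> 0 \<le> v t"
  note D = has_second_derivD[OF v]
  have iL: "integrable (Leb T) L" using L by (simp add: small_weight_def)
  obtain m where m: "m \<in> {0..T}" "\<And>t. t \<in> {0..T} \<Longrightarrow> v m \<le> v t"
    using continuous_attains_inf[OF _ _ D(5)] T by auto
  obtain x where x: "x \<in> {0..T}" "\<And>t. t \<in> {0..T} \<Longrightarrow> v t \<le> v x"
    using continuous_attains_sup[OF _ _ D(5)] T by auto
  have vm: "v m < 0" using neg m(2)[OF t] by simp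
  have M: "0 \<le> v x" using x(2)[of 0] bd T by simp
  have m_in: "0 < m" "m < T"
    using m(1) vm bd by (auto simp: less_le)
  \<comment> \<open>The minimum is interior since the boundary values are nonnegative.\<close>
  have pm: "p m = 0"
  proof (rule DERIV_local_min[where d = "min m (T - m)"])
    show "(v has_real_derivative p m) (at m)"
      using D(3)[OF m(1)] at_within_Icc_at[OF m_in] by simp
    show "\<forall>y. \<bar>m - y\<bar> < min m (T - m) \<longrightarrow> v m \<le> v y"
      by (auto intro!: m(2))
  qed (use m_in in auto)
  have g: "AE t in Leb T. g t \<le> v x * L t" by (rule ineq) (rule x(2))
  have iML: "integrable (Leb T) (\<lambda>t. v x * L t)" using iL by simp
  have gint: "integral {a..b} g \<le> v x * (1 / (2 * T)) + v x * (3 / (4 * T\<^sup>2)) * (b - a)"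
    if ab: "0 \<le> a" "a \<le> b" "b \<le> T" for a b
  proof -
    have "integral {a..b} g \<le> integral {a..b} (\<lambda>t. v x * L t)"
      by (rule integral_mono_AE_sub[OF D(1) iML g]) (use ab in auto)
    also have "\<dots> = v x * integral {a..b} L" by simp
    also have "\<dots> \<le> v x * (1 / (2 * T) + 3 / (4 * T\<^sup>2) * (b - a))"
      using L ab M by (intro mult_left_mono) (auto simp: small_weight_def)
    finally show ?thesis by (simp only: distrib_left mult.assoc)
  qed
  have pint: "p integrable_on {a..b}" if "0 \<le> a" "b \<le> T" for a b
    by (rule integrable_on_Leb_sub[OF continuous_imp_integrable_Leb[OF D(4)] that])
  have "v x - v m \<le> 7 / 8 * v x"
  proof (cases "m \<le> x")
    case True
    have "v x - v m = integral {m..x} p"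
      using has_second_deriv_increment(2)[OF v, of m x] True m(1) x(1) by simp
    also have "\<dots> \<le> v x * (1 / (2 * T)) * (x - m) + v x * (3 / (4 * T\<^sup>2)) * (x - m)\<^sup>2 / 2"
    proof (rule has_integral_le[OF _ has_integral_affine(1)[OF True]])
      show "(p has_integral integral {m..x} p) {m..x}"
        using pint[of m x] m(1) x(1) by (simp add: integrable_integral)
      fix s assume s: "s \<in> {m..x}"
      then have "p s = integral {m..s} g"
        using has_second_deriv_increment(1)[OF v, of m s] m(1) x(1) pm by simp
      then show "p s \<le> v x * (1 / (2 * T)) + v x * (3 / (4 * T\<^sup>2)) * (s - m)"
        using gint[of m s] s m(1) x(1) by simp
    qed
    also have "\<dots> \<le> 7 / 8 * v x"
      using affine_excursion_bound[OF T M, of "x - m"] True m(1) x(1) by simp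
    finally show ?thesis .
  next
    case False
    then have xm: "x \<le> m" by simp
    have "v x - v m = integral {x..m} (\<lambda>s. - p s)"
      using has_second_deriv_increment(2)[OF v, of x m] xm m(1) x(1) by simp
    also have "\<dots> \<le> v x * (1 / (2 * T)) * (m - x) + v x * (3 / (4 * T\<^sup>2)) * (m - x)\<^sup>2 / 2"
    proof (rule has_integral_le[OF _ has_integral_affine(2)[OF xm]])
      show "((\<lambda>s. - p s) has_integral integral {x..m} (\<lambda>s. - p s)) {x..m}"
        using pint[of x m] m(1) x(1) by (intro integrable_integral integrable_neg) simp
      fix s assume s: "s \<in> {x..m}"
      then have "- p s = integral {s..m} g"
        using has_second_deriv_increment(1)[OF v, of s m] m(1) x(1) pm by simp
      then show "- p s \<le> v x * (1 / (2 * T)) + v x * (3 / (4 * T\<^sup>2)) * (m - s)"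
        using gint[of s m] s m(1) x(1) by simp
    qed
    also have "\<dots> \<le> 7 / 8 * v x"
      using affine_excursion_bound[OF T M, of "m - x"] xm m(1) x(1) by simp
    finally show ?thesis .
  qed
  with vm M show False by simp
qed

text \<open>On the history interval the difference \<open>u' - u\<close> does not exceed its value at zero, so its maximum
over the whole interval is already an upper bound for the values at delayed arguments, and the
maximum principle applies to it on the interval from \<open>0\<close> to \<open>T\<close>.\<close>

lemma delay_comparison:
  fixes u u' L1 L2 \<tau> :: "real \<Rightarrow> real"
  assumes T: "0 < T" and \<tau>: "\<And>t. t \<in> {0..T} \<Longrightarrow> \<tau> t \<in> {-r..T}"
    and nonneg: "\<And>t. t \<in> {0..T} \<Longrightarrow> 0 \<le> L1 t" "\<And>t. t \<in> {0..T} \<Longrightarrow> 0 \<le> L2 t"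
    and small: "small_weight T (\<lambda>t. L1 t + L2 t)"
    and u: "has_second_deriv T u p g" and u': "has_second_deriv T u' p' g'"
    and ineq: "AE t in Leb T. g' t - g t \<le> L1 t * (u' t - u t) + L2 t * (u' (\<tau> t) - u (\<tau> t))"
    and init: "\<And>t. t \<in> {-r..0} \<Longrightarrow> u t \<le> u' t" "\<And>t. t \<in> {-r..0} \<Longrightarrow> u' t - u t \<le> u' 0 - u 0"
    and start: "u 0 \<le> u' 0" and final: "u T \<le> u' T"
    and t: "t \<in> {-r..T}"
  shows "u t \<le> u' t"
proof -
  have "0 \<le> u' s - u s" if s: "s \<in> {0..T}" for s
  proof (rule maximum_principle[OF T has_second_deriv_diff[OF u' u] _ _ small _ s])
    fix M assume M: "\<And>t. t \<in> {0..T} \<Longrightarrow> u' t - u t \<le> M"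
    have M': "u' t - u t \<le> M" if "t \<in> {-r..T}" for t
    proof (cases "0 \<le> t")
      case True then show ?thesis using M that by simp
    next
      case False
      then have "u' t - u t \<le> u' 0 - u 0" using init(2) that by simp
      also have "\<dots> \<le> M" using M T by simp
      finally show ?thesis .
    qed
    show "AE t in Leb T. g' t - g t \<le> M * (L1 t + L2 t)"
      using ineq AE_space
    proof eventually_elim
      case (elim t)
      then have "t \<in> {0..T}" by simp
      then have "L1 t * (u' t - u t) + L2 t * (u' (\<tau> t) - u (\<tau> t)) \<le> L1 t * M + L2 t * M"
        using nonneg M M' \<tau> by (intro add_mono mult_left_mono) auto
      with elim show ?case by (simp add: algebra_simps)
    qed
  qed (use start final in auto)
  then show ?thesis using init(1) t by (cases "0 \<le> t") auto
qed

section \<open>The linear problem with delay\<close>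

lemma measurable_delay_composition:
  fixes w \<tau> :: "real \<Rightarrow> real"
  assumes "\<tau> \<in> borel_measurable (Leb T)" "\<And>t. t \<in> {0..T} \<Longrightarrow> \<tau> t \<in> {-r..T}" "continuous_on {-r..T} w"
  shows "(\<lambda>t. w (\<tau> t)) \<in> borel_measurable (Leb T)"
proof -
  have "\<tau> \<in> measurable (Leb T) (restrict_space borel {-r..T})"
    by (rule measurable_restrict_space2) (use assms in auto)
  moreover have "w \<in> borel_measurable (restrict_space borel {-r..T})"
    by (rule borel_measurable_continuous_on_restrict) fact
  ultimately show ?thesis by (rule measurable_compose)
qed

lemma integrable_delay_terms:
  fixes L1 L2 w \<tau> :: "real \<Rightarrow> real"
  assumes T: "0 < T" and r: "0 \<le> r"
    and \<tau>: "\<tau> \<in> borel_measurable (Leb T)" "\<And>t. t \<in> {0..T} \<Longrightarrow> \<tau> t \<in> {-r..T}"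
    and L: "integrable (Leb T) L1" "integrable (Leb T) L2"
    and w: "continuous_on {-r..T} w"
  shows "integrable (Leb T) (\<lambda>t. L1 t * w t + L2 t * w (\<tau> t))"
proof -
  have "compact (w ` {-r..T})" by (rule compact_continuous_image[OF w]) simp
  then obtain K where K: "\<And>t. t \<in> {-r..T} \<Longrightarrow> \<bar>w t\<bar> \<le> K"
    using compact_imp_bounded bounded_iff by (metis image_eqI real_norm_def)
  have "continuous_on {0..T} w" by (rule continuous_on_subset[OF w]) (use r in auto)
  then have 1: "w \<in> borel_measurable (Leb T)"
    using continuous_imp_integrable_Leb by blast
  have "integrable (Leb T) (\<lambda>t. L1 t * w t)"
    by (rule integrable_mult_bounded[OF L(1) 1 K]) (use r in auto)
  moreover have "integrable (Leb T) (\<lambda>t. L2 t * w (\<tau> t))"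
    by (rule integrable_mult_bounded[OF L(2) measurable_delay_composition[OF \<tau> w] K]) (use \<tau> in auto)
  ultimately show ?thesis by simp
qed

text \<open>The left-hand side measures how far the primitive of \<open>R\<close> deviates from its chord. After splitting
the integral at \<open>t\<close>, each part contributes at most \<open>N t (T - t) / T \<le> N T / 4\<close>.\<close>

lemma chord_deviation_bound:
  fixes R :: "real \<Rightarrow> real"
  assumes T: "0 < T" and R: "continuous_on {0..T} R" and N: "\<And>s. s \<in> {0..T} \<Longrightarrow> \<bar>R s\<bar> \<le> N"
    and t: "t \<in> {0..T}"
  shows "\<bar>integral {0..t} R - t / T * integral {0..T} R\<bar> \<le> T / 2 * N"
proof -
  have i: "R integrable_on {0..T}" by (rule integrable_continuous_real[OF R])
  define X where "X = integral {0..t} R"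
  define Y where "Y = integral {t..T} R"
  have XY: "X + Y = integral {0..T} R"
    unfolding X_def Y_def by (rule Henstock_Kurzweil_Integration.integral_combine) (use t i in auto)
  have N0: "0 \<le> N" using N[of 0] T by auto
  have X: "\<bar>X\<bar> \<le> N * t"
    using integral_bound[of 0 t R N] t N continuous_on_subset[OF R] by (auto simp: X_def)
  have Y: "\<bar>Y\<bar> \<le> N * (T - t)"
    using integral_bound[of t T R N] t N continuous_on_subset[OF R] by (auto simp: Y_def)
  have "X - t / T * (X + Y) = ((T - t) * X - t * Y) / T" using T by (simp add: field_simps)
  also have "\<bar>\<dots>\<bar> \<le> ((T - t) * (N * t) + t * (N * (T - t))) / T"
  proof -
    have "\<bar>(T - t) * X - t * Y\<bar> \<le> (T - t) * \<bar>X\<bar> + t * \<bar>Y\<bar>"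
      using abs_triangle_ineq4[of "(T - t) * X" "t * Y"] t by (simp add: abs_mult)
    also have "\<dots> \<le> (T - t) * (N * t) + t * (N * (T - t))"
      using t X Y by (intro add_mono mult_left_mono) auto
    finally show ?thesis using T by (simp add: divide_right_mono)
  qed
  also have "\<dots> = N * (2 * (t * (T - t))) / T" by (simp add: algebra_simps)
  also have "\<dots> \<le> N * (T\<^sup>2 / 2) / T"
  proof (intro divide_right_mono mult_left_mono N0)
    show "2 * (t * (T - t)) \<le> T\<^sup>2 / 2"
      using zero_le_power2[of "T - 2 * t"] by (simp add: power2_eq_square algebra_simps)
  qed (use T in simp)
  also have "\<dots> = T / 2 * N" using T by (simp add: power2_eq_square)
  finally show ?thesis unfolding XY unfolding X_def .
qed

text \<open>Integrating twice turns the boundary value problem into a fixed point equation for a map \<open>V\<close> on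
continuous functions; the slope at zero is chosen to meet the condition at \<open>T\<close>. Since the total
mass of the weights is at most \<open>5 / (4 T)\<close>, the previous lemma makes the map a contraction with factor
\<open>T / 2 * (5 / (4 T)) = 5 / 8\<close>, and Banach's theorem applies. To work in the complete space of
bounded continuous functions on the whole line, functions are extended by constants beyond the
interval.\<close>

lemma linear_delay_problem_solvable:
  fixes \<phi> \<tau> L1 L2 h :: "real \<Rightarrow> real"
  assumes T: "0 < T" and r: "0 \<le> r" and \<phi>: "continuous_on {-r..0} \<phi>"
    and \<tau>: "\<tau> \<in> borel_measurable (Leb T)" "\<And>t. t \<in> {0..T} \<Longrightarrow> \<tau> t \<in> {-r..T}"
    and L: "integrable (Leb T) L1" "integrable (Leb T) L2"
    and nonneg: "\<And>t. t \<in> {0..T} \<Longrightarrow> 0 \<le> L1 t" "\<And>t. t \<in> {0..T} \<Longrightarrow> 0 \<le> L2 t"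
    and small: "integral {0..T} (\<lambda>t. L1 t + L2 t) \<le> 5 / (4 * T)"
    and h: "integrable (Leb T) h"
  obtains u p where "continuous_on {-r..T} u" "\<And>t. t \<in> {-r..0} \<Longrightarrow> u t = \<phi> t" "u T = B"
    "has_second_deriv T u p (\<lambda>t. L1 t * u t + L2 t * u (\<tau> t) - h t)"
proof -
  define q where "q w t = L1 t * w t + L2 t * w (\<tau> t) - h t" for w :: "real \<Rightarrow> real" and t
  define Q where "Q w t = integral {0..t} (q w)" for w t
  define I where "I w t = integral {0..t} (Q w)" for w t
  \<comment> \<open>\<open>sl w\<close> is the slope at zero for which the solution takes the value \<open>B\<close> at \<open>T\<close>.\<close>
  define sl where "sl w = (B - \<phi> 0 - I w T) / T" for w
  \<comment> \<open>The truncations at zero join the history and the integrated equation in one formula; 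
      for negative arguments the last two terms vanish.\<close>
  define V where "V w t = \<phi> (min t 0) + sl w * max t 0 + I w (max t 0)" for w t
  have q: "integrable (Leb T) (q w)" if "continuous_on {-r..T} w" for w
    unfolding q_def using integrable_delay_terms[OF T r \<tau> L that] h by simp
  have Q: "continuous_on {0..T} (Q w)" if "continuous_on {-r..T} w" for w
    unfolding Q_def by (rule continuous_on_primitive[OF q[OF that]])
  have I: "continuous_on {0..T} (I w)" if "continuous_on {-r..T} w" for w
    unfolding I_def by (rule continuous_on_primitive[OF continuous_imp_integrable_Leb[OF Q[OF that]]])
  have V: "continuous_on {-r..T} (V w)" if "continuous_on {-r..T} w" for w
    unfolding V_def
  proof (intro continuous_intros)
    show "continuous_on {-r..T} (\<lambda>x. \<phi> (min x 0))"
      by (rule continuous_on_compose2[OF \<phi>]) (use r in \<open>auto intro!: continuous_intros\<close>)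
    show "continuous_on {-r..T} (\<lambda>x. I w (max x 0))"
      by (rule continuous_on_compose2[OF I[OF that]]) (use T in \<open>auto intro!: continuous_intros\<close>)
  qed
  have w_cont: "continuous_on {-r..T} (apply_bcontfun w)" for w
    by (rule continuous_on_apply_bcontfun)
  have "\<exists>g :: real \<Rightarrow>\<^sub>C real. \<forall>x. g x = V (apply_bcontfun w) (clamp (-r) T x)" for w
    by (rule continuous_on_cbox_bcontfunE[of "-r" T "V (apply_bcontfun w)"])
      (use V[OF w_cont] in auto)
  then obtain \<Phi> :: "(real \<Rightarrow>\<^sub>C real) \<Rightarrow> (real \<Rightarrow>\<^sub>C real)"
    where \<Phi>: "\<And>w x. \<Phi> w x = V (apply_bcontfun w) (clamp (-r) T x)" by metis
  have contr: "dist (\<Phi> w) (\<Phi> w') \<le> 5 / 8 * dist w w'" for w w'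
  proof (rule dist_bound)
    fix x
    define \<delta> where "\<delta> = dist w w'"
    have \<delta>: "\<bar>w s - w' s\<bar> \<le> \<delta>" for s
      using dist_bounded[of w s w'] by (simp add: \<delta>_def dist_real_def)
    define y where "y = clamp (-r) T x"
    have "y \<in> cbox (-r) T" unfolding y_def by (rule clamp_in_interval) (use T r in auto)
    then have t: "max y 0 \<in> {0..T}" using T by auto
    note qw = q[OF w_cont[of w]] and qw' = q[OF w_cont[of w']]
    note Qw = Q[OF w_cont[of w]] and Qw' = Q[OF w_cont[of w']]
    let ?R = "\<lambda>s. Q w s - Q w' s"
    have R: "continuous_on {0..T} ?R" by (intro continuous_intros Qw Qw')
    have RN: "\<bar>?R s\<bar> \<le> \<delta> * (5 / (4 * T))" if s: "s \<in> {0..T}" for s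
    proof -
      have iL: "integrable (Leb T) (\<lambda>t. \<delta> * (L1 t + L2 t))" using L by simp
      have "?R s = integral {0..s} (\<lambda>t. q w t - q w' t)"
        using integrable_on_Leb_sub[OF qw, of 0 s] integrable_on_Leb_sub[OF qw', of 0 s] s
        by (simp add: Q_def Henstock_Kurzweil_Integration.integral_diff)
      also have "\<bar>\<dots>\<bar> \<le> integral {0..s} (\<lambda>t. \<delta> * (L1 t + L2 t))"
      proof (rule integral_abs_le_sub[OF _ iL])
        show "integrable (Leb T) (\<lambda>t. q w t - q w' t)" using qw qw' by simp
        show "AE t in Leb T. \<bar>q w t - q w' t\<bar> \<le> \<delta> * (L1 t + L2 t)"
        proof (rule AE_I2)
          fix t assume "t \<in> space (Leb T)"
          then have nn: "0 \<le> L1 t" "0 \<le> L2 t" using nonneg by auto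
          have "q w t - q w' t = L1 t * (w t - w' t) + L2 t * (w (\<tau> t) - w' (\<tau> t))"
            by (simp add: q_def algebra_simps)
          also have "\<bar>\<dots>\<bar> \<le> L1 t * \<bar>w t - w' t\<bar> + L2 t * \<bar>w (\<tau> t) - w' (\<tau> t)\<bar>"
            using nn abs_triangle_ineq[of "L1 t * (w t - w' t)" "L2 t * (w (\<tau> t) - w' (\<tau> t))"]
            by (simp add: abs_mult)
          also have "\<dots> \<le> L1 t * \<delta> + L2 t * \<delta>"
            using nn by (intro add_mono mult_left_mono \<delta>)
          finally show "\<bar>q w t - q w' t\<bar> \<le> \<delta> * (L1 t + L2 t)" by (simp add: algebra_simps)
        qed
      qed (use s in auto)
      also have "\<dots> \<le> integral {0..T} (\<lambda>t. \<delta> * (L1 t + L2 t))"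
      proof (rule integral_subset_le)
        show "\<forall>t\<in>{0..T}. 0 \<le> \<delta> * (L1 t + L2 t)"
          using nonneg by (simp add: \<delta>_def)
      qed (use s integrable_on_Leb_sub[OF iL, of 0 s] integrable_on_Leb_sub[OF iL, of 0 T] in auto)
      also have "\<dots> = \<delta> * integral {0..T} (\<lambda>t. L1 t + L2 t)" by simp
      also have "\<dots> \<le> \<delta> * (5 / (4 * T))"
        using small by (intro mult_left_mono) (auto simp: \<delta>_def)
      finally show ?thesis .
    qed
    have Idiff: "I w s - I w' s = integral {0..s} ?R" if s: "s \<in> {0..T}" for s
      unfolding I_def
      using integrable_on_Leb_sub[OF continuous_imp_integrable_Leb[OF Qw], of 0 s]
        integrable_on_Leb_sub[OF continuous_imp_integrable_Leb[OF Qw'], of 0 s] s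
      by (simp add: Henstock_Kurzweil_Integration.integral_diff)
    have "V w y - V w' y = (I w (max y 0) - I w' (max y 0)) - max y 0 / T * (I w T - I w' T)"
      using T by (simp add: V_def sl_def field_simps)
    also have "\<dots> = integral {0..max y 0} ?R - max y 0 / T * integral {0..T} ?R"
      using Idiff[OF t] Idiff[of T] T by simp
    also have "\<bar>\<dots>\<bar> \<le> T / 2 * (\<delta> * (5 / (4 * T)))"
      by (rule chord_deviation_bound[OF T R RN t])
    also have "\<dots> = 5 / 8 * \<delta>" using T by simp
    finally show "dist (\<Phi> w x) (\<Phi> w' x) \<le> 5 / 8 * dist w w'"
      by (simp add: \<Phi> y_def dist_real_def \<delta>_def)
  qed
  have "\<exists>!w. \<Phi> w = w"
    by (rule banach_fix_type[where c = "5 / 8"]) (use contr in auto)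
  then obtain w where w: "\<Phi> w = w" by blast
  have wV: "w t = V w t" if "t \<in> {-r..T}" for t
    using \<Phi>[of w t] w that by simp
  show ?thesis
  proof (rule that[of "apply_bcontfun w" "\<lambda>t. sl w + Q w t"])
    show "w t = \<phi> t" if "t \<in> {-r..0}" for t
      using wV[of t] that T by (simp add: V_def I_def)
    show "w T = B" using wV[of T] T r by (simp add: V_def sl_def)
    have wI: "\<phi> 0 + sl w * t + I w t = w t" if "t \<in> {0..T}" for t
      using wV[of t] that r by (simp add: V_def)
    have "has_second_deriv T w (\<lambda>t. sl w + Q w t) (q w)"
      unfolding has_second_deriv_def
    proof (intro conjI ballI q w_cont)
      fix t assume t: "t \<in> {0..T}"
      show "sl w + Q w t = sl w + Q w 0 + integral {0..t} (q w)" by (simp add: Q_def)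
      have "((\<lambda>t. \<phi> 0 + sl w * t + I w t) has_real_derivative sl w + Q w t) (at t within {0..T})"
        unfolding I_def using integral_has_real_derivative[OF Q[OF w_cont] t]
        by (auto intro!: derivative_eq_intros)
      then show "(w has_real_derivative sl w + Q w t) (at t within {0..T})"
        by (rule has_field_derivative_transform_within[where d = 1]) (use wI t in auto)
    qed
    then show "has_second_deriv T w (\<lambda>t. sl w + Q w t) (\<lambda>t. L1 t * w t + L2 t * w (\<tau> t) - h t)"
      by (simp only: q_def[abs_def])
  qed (rule w_cont)
qed

section \<open>Uniform Lipschitz bounds\<close>

lemma integral_subinterval_le_total:
  fixes \<rho> :: "real \<Rightarrow> real"
  assumes \<rho>: "integrable (Leb T) \<rho>" and nn: "AE t in Leb T. 0 \<le> \<rho> t"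
    and ab: "0 \<le> a" "a \<le> b" "b \<le> T"
  shows "integral {a..b} \<rho> \<le> integral {0..T} \<rho>"
proof -
  have "integral {a..b} (\<lambda>t. \<rho> t) = (LINT t|Leb T. indicator {a..b} t * \<rho> t)"
    using integral_Leb_indicator[OF \<rho>] ab by simp
  also have "\<dots> \<le> (LINT t|Leb T. \<rho> t)"
  proof (rule integral_mono_AE[OF _ \<rho>])
    have "{a..b} \<in> sets (Leb T)" using ab by (auto simp: sets_restrict_space_iff)
    from integrable_mult_indicator[OF this \<rho>]
    show "integrable (Leb T) (\<lambda>t. indicator {a..b} t * \<rho> t)" by simp
    show "AE t in Leb T. indicator {a..b} t * \<rho> t \<le> \<rho> t"
      using nn by eventually_elim (auto simp: indicator_def)
  qed
  also have "\<dots> = integral {0..T} \<rho>" by (rule integral_Leb_full[OF \<rho>])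
  finally show ?thesis .
qed

text \<open>By the mean value theorem the derivative equals the slope of the chord somewhere, and from there it
can move by no more than the integral of \<open>\<rho>\<close>. The constant depends only on the boundary
values and on \<open>\<rho>\<close>.\<close>

lemma second_deriv_bound_imp_lipschitz:
  assumes T: "0 < T" and u: "has_second_deriv T u p g"
    and \<rho>: "integrable (Leb T) \<rho>" and bound: "AE t in Leb T. \<bar>g t\<bar> \<le> \<rho> t"
    and s: "s \<in> {0..T}" and t: "t \<in> {0..T}"
  shows "\<bar>u s - u t\<bar> \<le> (\<bar>u T - u 0\<bar> / T + integral {0..T} \<rho>) * \<bar>s - t\<bar>"
proof -
  note D = has_second_derivD[OF u]
  define N where "N = \<bar>u T - u 0\<bar> / T + integral {0..T} \<rho>"
  have "\<exists>\<xi>\<in>{0<..<T}. u T - u 0 = p \<xi> * (T - 0)"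
    by (rule mvt_simple[OF T]) (use D(3) in \<open>simp add: has_field_derivative_def\<close>)
  then obtain \<xi> where "\<xi> \<in> {0<..<T}" "u T - u 0 = p \<xi> * (T - 0)" by blast
  then have \<xi>: "\<xi> \<in> {0..T}" "u T - u 0 = p \<xi> * T" by simp_all
  have osc: "\<bar>p b - p a\<bar> \<le> integral {0..T} \<rho>" if ab: "0 \<le> a" "a \<le> b" "b \<le> T" for a b
  proof -
    have "\<bar>integral {a..b} g\<bar> \<le> integral {a..b} \<rho>"
      by (rule integral_abs_le_sub[OF D(1) \<rho> bound ab(1,3)])
    also have "\<dots> \<le> integral {0..T} \<rho>"
    proof (rule integral_subinterval_le_total[OF \<rho> _ ab])
      show "AE t in Leb T. 0 \<le> \<rho> t" using bound by eventually_elim linarith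
    qed
    finally show ?thesis using has_second_deriv_increment(1)[OF u ab] by simp
  qed
  have pN: "\<bar>p x\<bar> \<le> N" if x: "x \<in> {0..T}" for x
  proof -
    have "\<bar>p x - p \<xi>\<bar> \<le> integral {0..T} \<rho>"
      using osc[of x \<xi>] osc[of \<xi> x] x \<xi>(1) by (cases "x \<le> \<xi>") (auto simp: abs_minus_commute)
    moreover have "\<bar>p \<xi>\<bar> = \<bar>u T - u 0\<bar> / T" using \<xi>(2) T by (simp add: abs_mult)
    ultimately show ?thesis unfolding N_def by linarith
  qed
  have incr: "\<bar>u b - u a\<bar> \<le> N * (b - a)" if ab: "0 \<le> a" "a \<le> b" "b \<le> T" for a b
    using integral_bound[of a b p N] has_second_deriv_increment(2)[OF u ab] ab pN
      continuous_on_subset[OF D(4)] by auto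
  show ?thesis
    using incr[of s t] incr[of t s] s t unfolding N_def[symmetric]
    by (cases "s \<le> t") (auto simp: abs_minus_commute)
qed

section \<open>Extremal fixed points of increasing maps\<close>

text \<open>The argument of Knaster and Tarski. An order interval of continuous functions is not a complete
lattice, but its members with a prescribed modulus of continuity \<open>\<omega>\<close> are closed under arbitrary
nonempty infima, and \<open>G\<close> maps into them. The least fixed point is the pointwise infimum of
the functions \<open>w\<close> with that modulus and \<open>G w \<le> w\<close>. Monotonicity takes the place of continuity of \<open>G\<close>,
which a discontinuous nonlinearity would not provide. Fixed points are understood up to values outside the interval.\<close>

lemma least_fixpoint_in_fun_interval:
  fixes G :: "(real \<Rightarrow> real) \<Rightarrow> (real \<Rightarrow> real)"
  assumes modulus: "\<And>u. (\<And>s t. s \<in> {-r..T} \<Longrightarrow> t \<in> {-r..T} \<Longrightarrow> \<bar>u s - u t\<bar> \<le> \<omega> s t) \<Longrightarrow> continuous_on {-r..T} u"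
    and G_in: "\<And>\<gamma>. \<gamma> \<in> fun_interval r T a b \<Longrightarrow> G \<gamma> \<in> fun_interval r T a b"
    and G_equi: "\<And>\<gamma> s t. \<gamma> \<in> fun_interval r T a b \<Longrightarrow> s \<in> {-r..T} \<Longrightarrow> t \<in> {-r..T} \<Longrightarrow>
        \<bar>G \<gamma> s - G \<gamma> t\<bar> \<le> \<omega> s t"
    and G_mono: "\<And>\<gamma> \<gamma>' t. \<gamma> \<in> fun_interval r T a b \<Longrightarrow> \<gamma>' \<in> fun_interval r T a b \<Longrightarrow>
        (\<And>s. s \<in> {-r..T} \<Longrightarrow> \<gamma> s \<le> \<gamma>' s) \<Longrightarrow> t \<in> {-r..T} \<Longrightarrow> G \<gamma> t \<le> G \<gamma>' t"
    and b_in: "b \<in> fun_interval r T a b"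
  obtains u where "u \<in> fun_interval r T a b" "\<And>t. t \<in> {-r..T} \<Longrightarrow> G u t = u t"
    "\<And>w t. w \<in> fun_interval r T a b \<Longrightarrow> (\<And>s. s \<in> {-r..T} \<Longrightarrow> G w s = w s) \<Longrightarrow> t \<in> {-r..T} \<Longrightarrow> u t \<le> w t"
proof -
  let ?J = "{-r..T}" and ?I = "fun_interval r T a b"
  define S where "S = {w \<in> ?I. (\<forall>s\<in>?J. \<forall>t\<in>?J. \<bar>w s - w t\<bar> \<le> \<omega> s t) \<and> (\<forall>t\<in>?J. G w t \<le> w t)}"
  have SD: "w \<in> ?I" "s \<in> ?J \<Longrightarrow> t \<in> ?J \<Longrightarrow> \<bar>w s - w t\<bar> \<le> \<omega> s t" "t \<in> ?J \<Longrightarrow> G w t \<le> w t"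
    "t \<in> ?J \<Longrightarrow> a t \<le> w t" "t \<in> ?J \<Longrightarrow> w t \<le> b t"
    if "w \<in> S" for w s t
    using that by (auto simp: S_def fun_interval_def)
  have SI: "G w \<in> S" if w: "w \<in> ?I" and le: "\<And>t. t \<in> ?J \<Longrightarrow> G w t \<le> w t" for w
    using G_in[OF w] G_equi[OF w] G_mono[OF G_in[OF w] w le] by (simp add: S_def)
  have "G b t \<le> b t" if "t \<in> ?J" for t
    using G_in[OF b_in] that by (auto simp: fun_interval_def)
  then have ne: "S \<noteq> {}" using SI[OF b_in] by blast
  define u where "u t = (INF w\<in>S. w t)" for t
  have bdd: "bdd_below ((\<lambda>w. w t) ` S)" if "t \<in> ?J" for t
    using SD(4)[OF _ that] by (auto intro!: bdd_belowI[of _ "a t"])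
  have lower: "u t \<le> w t" if "w \<in> S" "t \<in> ?J" for w t
    unfolding u_def by (rule cINF_lower[OF bdd[OF that(2)] that(1)])
  have greatest: "c \<le> u t" if "\<And>w. w \<in> S \<Longrightarrow> c \<le> w t" for c t
    unfolding u_def by (rule cINF_greatest[OF ne that])
  have one_sided: "u s - u t \<le> \<omega> s t" if st: "s \<in> ?J" "t \<in> ?J" for s t
  proof -
    have "u s - \<omega> s t \<le> u t"
    proof (rule greatest)
      fix w assume w: "w \<in> S"
      show "u s - \<omega> s t \<le> w t"
        using lower[OF w st(1)] SD(2)[OF w st] by linarith
    qed
    then show ?thesis by simp
  qed
  have equi: "\<bar>u s - u t\<bar> \<le> \<omega> s t" if st: "s \<in> ?J" "t \<in> ?J" for s t
  proof -
    have "u t - \<omega> s t \<le> u s"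
    proof (rule greatest)
      fix w assume w: "w \<in> S"
      show "u t - \<omega> s t \<le> w s"
        using lower[OF w st(2)] SD(2)[OF w st] by linarith
    qed
    then show ?thesis using one_sided[OF st] by linarith
  qed
  obtain w0 where w0: "w0 \<in> S" using ne by blast
  have uI: "u \<in> ?I"
    unfolding fun_interval_def
  proof (intro CollectI conjI ballI)
    show "continuous_on ?J u" by (rule modulus) (rule equi)
    fix t assume t: "t \<in> ?J"
    show "a t \<le> u t" by (rule greatest) (rule SD(4)[OF _ t])
    show "u t \<le> b t" using lower[OF w0 t] SD(5)[OF w0 t] by simp
  qed
  have Gu: "G u t \<le> u t" if t: "t \<in> ?J" for t
  proof (rule greatest)
    fix w assume w: "w \<in> S"
    have "G u t \<le> G w t" by (rule G_mono[OF uI SD(1)[OF w] lower[OF w] t])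
    also have "\<dots> \<le> w t" by (rule SD(3)[OF w t])
    finally show "G u t \<le> w t" .
  qed
  have fix_u: "G u t = u t" if "t \<in> ?J" for t
    using Gu[OF that] lower[OF SI[OF uI Gu] that] by simp
  have "u t \<le> w t" if w: "w \<in> ?I" "\<And>s. s \<in> ?J \<Longrightarrow> G w s = w s" and t: "t \<in> ?J" for w t
    using lower[OF SI[OF w(1)] t] w(2) t by auto
  then show ?thesis using that[OF uI fix_u] by blast
qed

text \<open>The previous lemma for the conjugate of \<open>G\<close> under \<open>\<gamma> \<mapsto> - \<gamma>\<close>.\<close>

lemma greatest_fixpoint_in_fun_interval:
  fixes G :: "(real \<Rightarrow> real) \<Rightarrow> (real \<Rightarrow> real)"
  assumes modulus: "\<And>u. (\<And>s t. s \<in> {-r..T} \<Longrightarrow> t \<in> {-r..T} \<Longrightarrow> \<bar>u s - u t\<bar> \<le> \<omega> s t) \<Longrightarrow> continuous_on {-r..T} u"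
    and G_in: "\<And>\<gamma>. \<gamma> \<in> fun_interval r T a b \<Longrightarrow> G \<gamma> \<in> fun_interval r T a b"
    and G_equi: "\<And>\<gamma> s t. \<gamma> \<in> fun_interval r T a b \<Longrightarrow> s \<in> {-r..T} \<Longrightarrow> t \<in> {-r..T} \<Longrightarrow>
        \<bar>G \<gamma> s - G \<gamma> t\<bar> \<le> \<omega> s t"
    and G_mono: "\<And>\<gamma> \<gamma>' t. \<gamma> \<in> fun_interval r T a b \<Longrightarrow> \<gamma>' \<in> fun_interval r T a b \<Longrightarrow>
        (\<And>s. s \<in> {-r..T} \<Longrightarrow> \<gamma> s \<le> \<gamma>' s) \<Longrightarrow> t \<in> {-r..T} \<Longrightarrow> G \<gamma> t \<le> G \<gamma>' t"
    and a_in: "a \<in> fun_interval r T a b"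
  obtains u where "u \<in> fun_interval r T a b" "\<And>t. t \<in> {-r..T} \<Longrightarrow> G u t = u t"
    "\<And>w t. w \<in> fun_interval r T a b \<Longrightarrow> (\<And>s. s \<in> {-r..T} \<Longrightarrow> G w s = w s) \<Longrightarrow> t \<in> {-r..T} \<Longrightarrow> w t \<le> u t"
proof -
  let ?n = "\<lambda>\<gamma> t. - \<gamma> t :: real"
  let ?I = "fun_interval r T a b" and ?I' = "fun_interval r T (?n b) (?n a)"
  have neg: "?n \<gamma> \<in> ?I \<longleftrightarrow> \<gamma> \<in> ?I'" for \<gamma>
    by (auto simp: fun_interval_def intro: continuous_on_minus dest: continuous_on_minus)
  have neg': "?n \<gamma> \<in> ?I' \<longleftrightarrow> \<gamma> \<in> ?I" for \<gamma>
    using neg[of "?n \<gamma>"] by simp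
  obtain u where u: "u \<in> ?I'" "\<And>t. t \<in> {-r..T} \<Longrightarrow> ?n (G (?n u)) t = u t"
    and least: "\<And>w t. w \<in> ?I' \<Longrightarrow> (\<And>s. s \<in> {-r..T} \<Longrightarrow> ?n (G (?n w)) s = w s) \<Longrightarrow> t \<in> {-r..T} \<Longrightarrow> u t \<le> w t"
  proof (rule least_fixpoint_in_fun_interval[where G = "\<lambda>\<gamma>. ?n (G (?n \<gamma>))" and \<omega> = \<omega>
        and a = "?n b" and b = "?n a" and r = r and T = T])
    show "continuous_on {-r..T} u" if "\<And>s t. s \<in> {-r..T} \<Longrightarrow> t \<in> {-r..T} \<Longrightarrow> \<bar>u s - u t\<bar> \<le> \<omega> s t" for u
      by (rule modulus) (rule that)
    show "?n (G (?n \<gamma>)) \<in> ?I'" if "\<gamma> \<in> ?I'" for \<gamma>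
      using G_in[of "?n \<gamma>"] that neg neg' by blast
    show "\<bar>?n (G (?n \<gamma>)) s - ?n (G (?n \<gamma>)) t\<bar> \<le> \<omega> s t"
      if "\<gamma> \<in> ?I'" "s \<in> {-r..T}" "t \<in> {-r..T}" for \<gamma> s t
      using G_equi[of "?n \<gamma>" s t] that(2,3) neg[of \<gamma>] that(1) by (simp add: abs_minus_commute)
    show "?n (G (?n \<gamma>)) t \<le> ?n (G (?n \<gamma>')) t"
      if "\<gamma> \<in> ?I'" "\<gamma>' \<in> ?I'" "\<And>s. s \<in> {-r..T} \<Longrightarrow> \<gamma> s \<le> \<gamma>' s" "t \<in> {-r..T}" for \<gamma> \<gamma>' t
      using G_mono[of "?n \<gamma>'" "?n \<gamma>" t] that neg by auto
    show "?n a \<in> ?I'" using a_in neg' by blast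
  qed blast
  show ?thesis
  proof (rule that[of "?n u"])
    show "?n u \<in> ?I" using u(1) neg by blast
    show "G (?n u) t = ?n u t" if "t \<in> {-r..T}" for t using u(2)[OF that] by simp
    show "w t \<le> ?n u t"
      if "w \<in> ?I" "\<And>s. s \<in> {-r..T} \<Longrightarrow> G w s = w s" "t \<in> {-r..T}" for w t
      using least[of "?n w" t] that neg' by auto
  qed
qed

section \<open>Smallness of the weights\<close>

lemma integrable_const_Leb: "integrable (Leb T) (\<lambda>t. c :: real)"
  by (rule continuous_imp_integrable_Leb) simp

lemma small_weight_Linf:
  fixes L1 L2 :: "real \<Rightarrow> real"
  assumes T: "0 < T"
    and nonneg: "\<And>t. t \<in> {0..T} \<Longrightarrow> 0 \<le> L1 t" "\<And>t. t \<in> {0..T} \<Longrightarrow> 0 \<le> L2 t"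
    and L: "L1 \<in> Linf_space (Leb T)" "L2 \<in> Linf_space (Leb T)"
    and norm: "Linf_norm (Leb T) (\<lambda>t. L1 t + L2 t) < ereal (1 / T^2)"
  shows "integrable (Leb T) L1" "integrable (Leb T) L2" "small_weight T (\<lambda>t. L1 t + L2 t)"
proof -
  have m: "L1 \<in> borel_measurable (Leb T)" "L2 \<in> borel_measurable (Leb T)"
    using L by (auto simp: Linf_space_def)
  have bound: "AE t in Leb T. L1 t + L2 t \<le> 1 / T\<^sup>2"
    using esssup_AE[of "\<lambda>t. ereal \<bar>L1 t + L2 t\<bar>" "Leb T"]
  proof eventually_elim
    case (elim t)
    then have "ereal \<bar>L1 t + L2 t\<bar> < ereal (1 / T^2)"
      using norm unfolding Linf_norm_def by (rule le_less_trans)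
    then show ?case by simp
  qed
  show 1: "integrable (Leb T) L1"
  proof (rule Bochner_Integration.integrable_bound[OF integrable_const_Leb m(1)])
    show "AE t in Leb T. norm (L1 t) \<le> norm (1 / T\<^sup>2)"
      using bound AE_space by eventually_elim (use nonneg in fastforce)
  qed
  show 2: "integrable (Leb T) L2"
  proof (rule Bochner_Integration.integrable_bound[OF integrable_const_Leb m(2)])
    show "AE t in Leb T. norm (L2 t) \<le> norm (1 / T\<^sup>2)"
      using bound AE_space by eventually_elim (use nonneg in fastforce)
  qed
  show "small_weight T (\<lambda>t. L1 t + L2 t)"
    unfolding small_weight_def
  proof (intro conjI allI impI)
    show i: "integrable (Leb T) (\<lambda>t. L1 t + L2 t)" using 1 2 by simp
    fix a b :: real assume ab: "0 \<le> a" "a \<le> b" "b \<le> T"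
    have "integral {a..b} (\<lambda>t. L1 t + L2 t) \<le> integral {a..b} (\<lambda>t. 1 / T\<^sup>2)"
      by (rule integral_mono_AE_sub[OF i integrable_const_Leb bound ab(1,3)])
    also have "\<dots> = (b - a) / T\<^sup>2" using ab by simp
    also have "\<dots> \<le> 1 / (2 * T) + 3 / (4 * T\<^sup>2) * (b - a)"
    proof -
      have "(b - a) / (4 * T\<^sup>2) \<le> 2 * T / (4 * T\<^sup>2)"
        by (rule divide_right_mono) (use ab T in auto)
      also have "\<dots> = 1 / (2 * T)" using T by (simp add: power2_eq_square)
      finally have "(b - a) / (4 * T\<^sup>2) \<le> 1 / (2 * T)" .
      moreover have "(b - a) / T\<^sup>2 = (b - a) / (4 * T\<^sup>2) + 3 / (4 * T\<^sup>2) * (b - a)"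
        using T by (simp add: field_simps)
      ultimately show ?thesis by linarith
    qed
    finally show "integral {a..b} (\<lambda>t. L1 t + L2 t) \<le> 1 / (2 * T) + 3 / (4 * T\<^sup>2) * (b - a)" .
  qed
qed

text \<open>The pointwise inequality \<open>x \<le> T\<^sup>2 / 3 * x\<^sup>2 + 3 / (4 T\<^sup>2)\<close> between arithmetic and geometric mean replaces
the Cauchy-Schwarz inequality and produces the affine bound at once.\<close>

lemma small_weight_L2:
  fixes L1 L2 :: "real \<Rightarrow> real"
  assumes T: "0 < T"
    and L: "L1 \<in> Lp_space 2 (Leb T)" "L2 \<in> Lp_space 2 (Leb T)"
    and norm: "Lp_norm 2 (Leb T) (\<lambda>t. L1 t + L2 t) < (3 / (2 * T^3)) powr (1/2)"
  shows "integrable (Leb T) L1" "integrable (Leb T) L2" "small_weight T (\<lambda>t. L1 t + L2 t)"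
proof -
  have m[measurable]: "L1 \<in> borel_measurable (Leb T)" "L2 \<in> borel_measurable (Leb T)"
    and sq: "integrable (Leb T) (\<lambda>t. (L1 t)\<^sup>2)" "integrable (Leb T) (\<lambda>t. (L2 t)\<^sup>2)"
    using L by (auto simp: Lp_space_def)
  have int: "integrable (Leb T) f" if "f \<in> borel_measurable (Leb T)" "integrable (Leb T) (\<lambda>t. (f t)\<^sup>2)"
    for f :: "real \<Rightarrow> real"
  proof (rule Bochner_Integration.integrable_bound[OF _ that(1)])
    show "integrable (Leb T) (\<lambda>t. 1 + (f t)\<^sup>2)"
      using that(2) integrable_const_Leb by (intro Bochner_Integration.integrable_add)
    have "\<bar>x\<bar> \<le> 1 + x\<^sup>2" for x :: real
      using sum_squares_ge_zero[of "\<bar>x\<bar> - 1/2" 0] by (simp add: power2_eq_square algebra_simps)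
    then show "AE t in Leb T. norm (f t) \<le> norm (1 + (f t)\<^sup>2)"
      by (intro AE_I2) (simp add: abs_of_nonneg)
  qed
  show 1: "integrable (Leb T) L1" and 2: "integrable (Leb T) L2"
    by (rule int[OF m(1) sq(1)], rule int[OF m(2) sq(2)])
  have sumsq: "integrable (Leb T) (\<lambda>t. (L1 t + L2 t)\<^sup>2)"
  proof (rule Bochner_Integration.integrable_bound)
    show "integrable (Leb T) (\<lambda>t. 2 * ((L1 t)\<^sup>2 + (L2 t)\<^sup>2))" using sq by simp
    have "(x + y)\<^sup>2 \<le> 2 * (x\<^sup>2 + y\<^sup>2)" for x y :: real
      using zero_le_power2[of "x - y"] by (simp add: power2_eq_square algebra_simps)
    then show "AE t in Leb T. norm ((L1 t + L2 t)\<^sup>2) \<le> norm (2 * ((L1 t)\<^sup>2 + (L2 t)\<^sup>2))"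
      by (intro AE_I2) simp
  qed measurable
  let ?E = "LINT t|Leb T. (L1 t + L2 t)\<^sup>2"
  have E: "?E \<le> 3 / (2 * T^3)"
  proof (rule ccontr)
    assume "\<not> ?thesis"
    then have "(3 / (2 * T^3)) powr (1/2) \<le> ?E powr (1/2)"
      using T by (intro powr_mono2) auto
    then show False using norm by (simp add: Lp_norm_def)
  qed
  show "small_weight T (\<lambda>t. L1 t + L2 t)"
    unfolding small_weight_def
  proof (intro conjI allI impI)
    show i: "integrable (Leb T) (\<lambda>t. L1 t + L2 t)" using 1 2 by simp
    fix a b :: real assume ab: "0 \<le> a" "a \<le> b" "b \<le> T"
    have i3: "integrable (Leb T) (\<lambda>t. T\<^sup>2 / 3 * (L1 t + L2 t)\<^sup>2)" using sumsq by simp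
    have amgm: "x \<le> T\<^sup>2 / 3 * x\<^sup>2 + 3 / (4 * T\<^sup>2)" for x
    proof -
      have "0 \<le> (2 * T\<^sup>2 * x - 3)\<^sup>2 / (12 * T\<^sup>2)" by simp
      also have "\<dots> = T\<^sup>2 / 3 * x\<^sup>2 + 3 / (4 * T\<^sup>2) - x"
        using T by (simp add: power2_eq_square field_simps)
      finally show ?thesis by simp
    qed
    have "integral {a..b} (\<lambda>t. L1 t + L2 t)
        \<le> integral {a..b} (\<lambda>t. T\<^sup>2 / 3 * (L1 t + L2 t)\<^sup>2 + 3 / (4 * T\<^sup>2))"
      by (rule integral_mono_AE_sub[OF i Bochner_Integration.integrable_add[OF i3 integrable_const_Leb] AE_I2 ab(1,3)])
        (rule amgm)
    also have "\<dots> = integral {a..b} (\<lambda>t. T\<^sup>2 / 3 * (L1 t + L2 t)\<^sup>2) + integral {a..b} (\<lambda>t. 3 / (4 * T\<^sup>2))"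
      by (intro Henstock_Kurzweil_Integration.integral_add integrable_on_Leb_sub[OF i3 ab(1,3)] integrable_const_ivl)
    also have "integral {a..b} (\<lambda>t. 3 / (4 * T\<^sup>2)) = 3 / (4 * T\<^sup>2) * (b - a)" using ab by simp
    also have "integral {a..b} (\<lambda>t. T\<^sup>2 / 3 * (L1 t + L2 t)\<^sup>2) \<le> integral {0..T} (\<lambda>t. T\<^sup>2 / 3 * (L1 t + L2 t)\<^sup>2)"
      by (rule integral_subinterval_le_total[OF i3 _ ab]) simp
    also have "\<dots> = T\<^sup>2 / 3 * ?E"
      by (simp add: integral_Leb_full[OF sumsq])
    also have "\<dots> \<le> T\<^sup>2 / 3 * (3 / (2 * T^3))"
      by (rule mult_left_mono[OF E]) simp
    also have "\<dots> = 1 / (2 * T)"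
      using T by (simp add: power2_eq_square power3_eq_cube)
    finally show "integral {a..b} (\<lambda>t. L1 t + L2 t) \<le> 1 / (2 * T) + 3 / (4 * T\<^sup>2) * (b - a)"
      by simp
  qed
qed

lemma small_weight_L1:
  fixes L1 L2 :: "real \<Rightarrow> real"
  assumes T: "0 < T"
    and nonneg: "\<And>t. t \<in> {0..T} \<Longrightarrow> 0 \<le> L1 t" "\<And>t. t \<in> {0..T} \<Longrightarrow> 0 \<le> L2 t"
    and L: "L1 \<in> Lp_space 1 (Leb T)" "L2 \<in> Lp_space 1 (Leb T)"
    and norm: "Lp_norm 1 (Leb T) (\<lambda>t. L1 t + L2 t) < 1 / (2 * T)"
  shows "integrable (Leb T) L1" "integrable (Leb T) L2" "small_weight T (\<lambda>t. L1 t + L2 t)"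
proof -
  show 1: "integrable (Leb T) L1" and 2: "integrable (Leb T) L2"
    using L by (auto simp: Lp_space_1)
  show "small_weight T (\<lambda>t. L1 t + L2 t)"
    unfolding small_weight_def
  proof (intro conjI allI impI)
    show i: "integrable (Leb T) (\<lambda>t. L1 t + L2 t)" using 1 2 by simp
    fix a b :: real assume ab: "0 \<le> a" "a \<le> b" "b \<le> T"
    have nn: "AE t in Leb T. 0 \<le> L1 t + L2 t"
      using nonneg by (intro AE_I2) simp
    have "integral {a..b} (\<lambda>t. L1 t + L2 t) \<le> integral {0..T} (\<lambda>t. L1 t + L2 t)"
      by (rule integral_subinterval_le_total[OF i nn ab])
    also have "\<dots> = (LINT t|Leb T. L1 t + L2 t)" by (rule integral_Leb_full[OF i, symmetric])
    also have "\<dots> = Lp_norm 1 (Leb T) (\<lambda>t. L1 t + L2 t)"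
    proof -
      have "(LINT t|Leb T. \<bar>L1 t + L2 t\<bar> powr 1) = (LINT t|Leb T. L1 t + L2 t)"
        using nonneg by (intro Bochner_Integration.integral_cong) auto
      moreover have "0 \<le> (LINT t|Leb T. L1 t + L2 t)"
        by (rule integral_nonneg_AE[OF nn])
      ultimately show ?thesis by (simp add: Lp_norm_def)
    qed
    also have "\<dots> \<le> 1 / (2 * T) + 3 / (4 * T\<^sup>2) * (b - a)"
      using norm ab by (simp add: add_increasing2)
    finally show "integral {a..b} (\<lambda>t. L1 t + L2 t) \<le> 1 / (2 * T) + 3 / (4 * T\<^sup>2) * (b - a)" .
  qed
qed

text \<open>For \<open>T < 3/4\<close> the bound on the quadratic norm is the more restrictive one, so that both ranges of \<open>T\<close>
are covered by the condition for large \<open>T\<close>.\<close>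

lemma L2_threshold_for_small_T:
  fixes T :: real
  assumes "0 < T" "T < 3/4"
  shows "sqrt 2 / T \<le> (3 / (2 * T^3)) powr (1/2)"
proof -
  have "sqrt 2 / T = sqrt (2 / T\<^sup>2)" using assms by (simp add: real_sqrt_divide)
  also have "\<dots> \<le> sqrt (3 / (2 * T^3))"
    using assms by (simp add: field_simps power2_eq_square power3_eq_cube)
  also have "\<dots> = (3 / (2 * T^3)) powr (1/2)" using assms by (simp add: powr_half_sqrt)
  finally show ?thesis .
qed

section \<open>Extremal solutions\<close>

theorem theorem3p1:
  fixes T r B :: real
    and \<phi> \<tau> \<alpha> \<beta> \<psi> L1 L2 :: "real \<Rightarrow> real"
    and f :: "real \<Rightarrow> real \<Rightarrow> real \<Rightarrow> real"
  assumes T_pos: "T > 0"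
    and r_nonneg: "r \<ge> 0"
    and phi_cont: "continuous_on {-r..0} \<phi>"
    and tau_range: "\<And>t. t \<in> {0..T} \<Longrightarrow> \<tau> t \<in> {-r..T}"
    and tau_meas: "\<tau> \<in> borel_measurable (Leb T)"
    and lower: "is_lower_solution r T \<phi> B \<tau> f \<alpha>"
    and upper: "is_upper_solution r T \<phi> B \<tau> f \<beta>"
    and ordered: "\<And>t. t \<in> {-r..T} \<Longrightarrow> \<alpha> t \<le> \<beta> t"
    and f_meas: "\<And>\<gamma>. \<gamma> \<in> fun_interval r T \<alpha> \<beta> \<Longrightarrow>
        (\<lambda>t. f t (\<gamma> t) (\<gamma> (\<tau> t))) \<in> borel_measurable (Leb T)"
    and psi_L1: "\<psi> \<in> Lp_space 1 (Leb T)"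
    and psi_nonneg: "\<And>t. t \<in> {0..T} \<Longrightarrow> \<psi> t \<ge> 0"
    and f_bound: "AE t in Leb T. \<forall>x\<in>{\<alpha> t..\<beta> t}. \<forall>y\<in>{\<alpha> (\<tau> t)..\<beta> (\<tau> t)}. \<bar>f t x y\<bar> \<le> \<psi> t"
    and L1_nonneg: "\<And>t. t \<in> {0..T} \<Longrightarrow> L1 t \<ge> 0"
    and L2_nonneg: "\<And>t. t \<in> {0..T} \<Longrightarrow> L2 t \<ge> 0"
    and f_one_sided: "AE t in Leb T. \<forall>x x' y y'.
        \<alpha> t \<le> x \<and> x \<le> x' \<and> x' \<le> \<beta> t \<and>
        \<alpha> (\<tau> t) \<le> y \<and> y \<le> y' \<and> y' \<le> \<beta> (\<tau> t) \<longrightarrow>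
        f t x' y' - f t x y \<ge> - L1 t * (x' - x) - L2 t * (y' - y)"
    and L_large_T: "T \<ge> 3/4 \<Longrightarrow>
        (L1 \<in> Linf_space (Leb T) \<and> L2 \<in> Linf_space (Leb T) \<and>
          Linf_norm (Leb T) (\<lambda>t. L1 t + L2 t) < ereal (1 / T^2)) \<or>
        (L1 \<in> Lp_space 2 (Leb T) \<and> L2 \<in> Lp_space 2 (Leb T) \<and>
          Lp_norm 2 (Leb T) (\<lambda>t. L1 t + L2 t) < (3 / (2 * T^3)) powr (1/2)) \<or>
        (L1 \<in> Lp_space 1 (Leb T) \<and> L2 \<in> Lp_space 1 (Leb T) \<and>
          Lp_norm 1 (Leb T) (\<lambda>t. L1 t + L2 t) < 1 / (2 * T))"
    and L_small_T: "T < 3/4 \<Longrightarrow>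
        (L1 \<in> Linf_space (Leb T) \<and> L2 \<in> Linf_space (Leb T) \<and>
          Linf_norm (Leb T) (\<lambda>t. L1 t + L2 t) < ereal (1 / T^2)) \<or>
        (L1 \<in> Lp_space 2 (Leb T) \<and> L2 \<in> Lp_space 2 (Leb T) \<and>
          Lp_norm 2 (Leb T) (\<lambda>t. L1 t + L2 t) < sqrt 2 / T) \<or>
        (L1 \<in> Lp_space 1 (Leb T) \<and> L2 \<in> Lp_space 1 (Leb T) \<and>
          Lp_norm 1 (Leb T) (\<lambda>t. L1 t + L2 t) < 1 / (2 * T))"
  shows "\<exists>u_min u_max.
      u_min \<in> X_space r T \<inter> fun_interval r T \<alpha> \<beta> \<and> is_solution r T \<phi> B \<tau> f u_min \<and>
      u_max \<in> X_space r T \<inter> fun_interval r T \<alpha> \<beta> \<and> is_solution r T \<phi> B \<tau> f u_max \<and>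
      (\<forall>u \<in> X_space r T \<inter> fun_interval r T \<alpha> \<beta>. is_solution r T \<phi> B \<tau> f u \<longrightarrow>
        (\<forall>t\<in>{-r..T}. u_min t \<le> u t \<and> u t \<le> u_max t))"
proof -
  let ?J = "{-r..T}" and ?I = "fun_interval r T \<alpha> \<beta>"
  have weights: "integrable (Leb T) L1 \<and> integrable (Leb T) L2 \<and> small_weight T (\<lambda>t. L1 t + L2 t)"
  proof -
    have "(L1 \<in> Linf_space (Leb T) \<and> L2 \<in> Linf_space (Leb T) \<and>
          Linf_norm (Leb T) (\<lambda>t. L1 t + L2 t) < ereal (1 / T^2)) \<or>
        (L1 \<in> Lp_space 2 (Leb T) \<and> L2 \<in> Lp_space 2 (Leb T) \<and>
          Lp_norm 2 (Leb T) (\<lambda>t. L1 t + L2 t) < (3 / (2 * T^3)) powr (1/2)) \<or>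
        (L1 \<in> Lp_space 1 (Leb T) \<and> L2 \<in> Lp_space 1 (Leb T) \<and>
          Lp_norm 1 (Leb T) (\<lambda>t. L1 t + L2 t) < 1 / (2 * T))"
    proof (cases "T < 3/4")
      case True
      then show ?thesis
        using L_small_T less_le_trans[OF _ L2_threshold_for_small_T[OF T_pos True]] by blast
    next
      case False
      then show ?thesis using L_large_T by linarith
    qed
    then show ?thesis
    proof (elim disjE conjE)
      assume "L1 \<in> Linf_space (Leb T)" "L2 \<in> Linf_space (Leb T)"
        "Linf_norm (Leb T) (\<lambda>t. L1 t + L2 t) < ereal (1 / T^2)"
      from small_weight_Linf[OF T_pos L1_nonneg L2_nonneg this] show ?thesis by (intro conjI)
    next
      assume "L1 \<in> Lp_space 2 (Leb T)" "L2 \<in> Lp_space 2 (Leb T)"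
        "Lp_norm 2 (Leb T) (\<lambda>t. L1 t + L2 t) < (3 / (2 * T^3)) powr (1/2)"
      from small_weight_L2[OF T_pos this] show ?thesis by (intro conjI)
    next
      assume "L1 \<in> Lp_space 1 (Leb T)" "L2 \<in> Lp_space 1 (Leb T)"
        "Lp_norm 1 (Leb T) (\<lambda>t. L1 t + L2 t) < 1 / (2 * T)"
      from small_weight_L1[OF T_pos L1_nonneg L2_nonneg this] show ?thesis by (intro conjI)
    qed
  qed
  then have iL: "integrable (Leb T) L1" "integrable (Leb T) L2"
    and small: "small_weight T (\<lambda>t. L1 t + L2 t)" by auto
  have \<alpha>: "continuous_on ?J \<alpha>" "\<alpha> \<in> W21 T"
      "AE t in Leb T. - weak_deriv2 T \<alpha> t \<le> f t (\<alpha> t) (\<alpha> (\<tau> t))"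
      "\<And>t. t \<in> {-r..0} \<Longrightarrow> \<alpha> t \<le> \<phi> t" "\<And>t. t \<in> {-r..0} \<Longrightarrow> \<phi> t - \<alpha> t \<le> \<phi> 0 - \<alpha> 0" "\<alpha> T \<le> B"
    using lower by (auto simp: is_lower_solution_def X_space_def)
  have \<beta>: "continuous_on ?J \<beta>" "\<beta> \<in> W21 T"
      "AE t in Leb T. f t (\<beta> t) (\<beta> (\<tau> t)) \<le> - weak_deriv2 T \<beta> t"
      "\<And>t. t \<in> {-r..0} \<Longrightarrow> \<phi> t \<le> \<beta> t" "\<And>t. t \<in> {-r..0} \<Longrightarrow> \<beta> t - \<phi> t \<le> \<beta> 0 - \<phi> 0" "B \<le> \<beta> T"
    using upper by (auto simp: is_upper_solution_def X_space_def)
  have ID: "continuous_on ?J \<gamma>" "t \<in> ?J \<Longrightarrow> \<alpha> t \<le> \<gamma> t" "t \<in> ?J \<Longrightarrow> \<gamma> t \<le> \<beta> t"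
    if "\<gamma> \<in> ?I" for \<gamma> t
    using that by (auto simp: fun_interval_def)
  have \<alpha>I: "\<alpha> \<in> ?I" and \<beta>I: "\<beta> \<in> ?I"
    using \<alpha>(1) \<beta>(1) ordered by (auto simp: fun_interval_def)
  have in_J: "t \<in> ?J" "\<tau> t \<in> ?J" if "t \<in> {0..T}" for t
    using that r_nonneg tau_range by auto
  have J0: "continuous_on {0..T} w" if "continuous_on ?J w" for w :: "real \<Rightarrow> real"
    by (rule continuous_on_subset[OF that]) (use r_nonneg in auto)
  have on_J: "AE t in Leb T. t \<in> ?J \<and> \<tau> t \<in> ?J"
    using in_J by (intro AE_I2) simp

  \<comment> \<open>\<open>G \<gamma>\<close> is to solve the linear problem whose right-hand side \<open>h \<gamma>\<close> freezes \<open>f\<close> along \<open>\<gamma>\<close>. The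
      added weights turn the one-sided Lipschitz condition into monotonicity of \<open>h\<close>.\<close>
  define F where "F \<gamma> t = f t (\<gamma> t) (\<gamma> (\<tau> t))" for \<gamma> t
  define h where "h \<gamma> t = F \<gamma> t + (L1 t * \<gamma> t + L2 t * \<gamma> (\<tau> t))" for \<gamma> t
  have F_bound: "AE t in Leb T. \<bar>F \<gamma> t\<bar> \<le> \<psi> t" if "\<gamma> \<in> ?I" for \<gamma>
    using f_bound on_J by eventually_elim (simp add: F_def ID[OF that])
  have i\<psi>: "integrable (Leb T) \<psi>" using psi_L1 by (simp add: Lp_space_1)
  have iF: "integrable (Leb T) (F \<gamma>)" if "\<gamma> \<in> ?I" for \<gamma>
  proof (rule Bochner_Integration.integrable_bound[OF i\<psi>])
    show "F \<gamma> \<in> borel_measurable (Leb T)" using f_meas[OF that] by (simp add: F_def[abs_def])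
    show "AE t in Leb T. norm (F \<gamma> t) \<le> norm (\<psi> t)"
      using F_bound[OF that] by eventually_elim simp
  qed
  have ih: "integrable (Leb T) (h \<gamma>)" if "\<gamma> \<in> ?I" for \<gamma>
    unfolding h_def
    by (intro Bochner_Integration.integrable_add[OF iF[OF that]]
        integrable_delay_terms[where \<tau> = \<tau> and ?L1.0 = L1 and ?L2.0 = L2 and T = T and r = r, OF T_pos r_nonneg tau_meas tau_range iL ID(1)[OF that]])
  have h_mono: "AE t in Leb T. h \<gamma> t \<le> h \<gamma>' t"
    if \<gamma>: "\<gamma> \<in> ?I" "\<gamma>' \<in> ?I" and le: "\<And>s. s \<in> ?J \<Longrightarrow> \<gamma> s \<le> \<gamma>' s" for \<gamma> \<gamma>'
    using f_one_sided on_J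
  proof eventually_elim
    case (elim t)
    have "\<alpha> t \<le> \<gamma> t \<and> \<gamma> t \<le> \<gamma>' t \<and> \<gamma>' t \<le> \<beta> t \<and>
        \<alpha> (\<tau> t) \<le> \<gamma> (\<tau> t) \<and> \<gamma> (\<tau> t) \<le> \<gamma>' (\<tau> t) \<and> \<gamma>' (\<tau> t) \<le> \<beta> (\<tau> t)"
      using elim(2) by (intro conjI ID(2)[OF \<gamma>(1)] ID(3)[OF \<gamma>(2)] le) auto
    then have "f t (\<gamma>' t) (\<gamma>' (\<tau> t)) - f t (\<gamma> t) (\<gamma> (\<tau> t))
        \<ge> - L1 t * (\<gamma>' t - \<gamma> t) - L2 t * (\<gamma>' (\<tau> t) - \<gamma> (\<tau> t))"
      by (rule elim(1)[rule_format])
    then show ?case by (simp add: h_def F_def algebra_simps)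
  qed

  define solves where "solves \<gamma> u p \<longleftrightarrow> continuous_on ?J u \<and> (\<forall>t\<in>{-r..0}. u t = \<phi> t) \<and> u T = B \<and>
      has_second_deriv T u p (\<lambda>t. L1 t * u t + L2 t * u (\<tau> t) - h \<gamma> t)" for \<gamma> u p
  have "\<exists>u p. solves \<gamma> u p" if \<gamma>: "\<gamma> \<in> ?I" for \<gamma>
  proof (rule linear_delay_problem_solvable[where \<tau> = \<tau> and ?L1.0 = L1 and ?L2.0 = L2, OF T_pos r_nonneg
        phi_cont tau_meas tau_range iL L1_nonneg L2_nonneg small_weight_total[OF T_pos small] ih[OF \<gamma>], of B])
    fix u p
    assume "continuous_on ?J u" "\<And>t. t \<in> {-r..0} \<Longrightarrow> u t = \<phi> t" "u T = B"
      "has_second_deriv T u p (\<lambda>t. L1 t * u t + L2 t * u (\<tau> t) - h \<gamma> t)"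
    then have "solves \<gamma> u p" unfolding solves_def by blast
    then show ?thesis by blast
  qed
  then obtain G P where "\<And>\<gamma>. \<gamma> \<in> ?I \<Longrightarrow> solves \<gamma> (G \<gamma>) (P \<gamma>)"
    by metis
  then have G: "\<And>\<gamma>. \<gamma> \<in> ?I \<Longrightarrow> continuous_on ?J (G \<gamma>)"
      "\<And>\<gamma> t. \<gamma> \<in> ?I \<Longrightarrow> t \<in> {-r..0} \<Longrightarrow> G \<gamma> t = \<phi> t" "\<And>\<gamma>. \<gamma> \<in> ?I \<Longrightarrow> G \<gamma> T = B"
    and GP: "\<And>\<gamma>. \<gamma> \<in> ?I \<Longrightarrow>
      has_second_deriv T (G \<gamma>) (P \<gamma>) (\<lambda>t. L1 t * G \<gamma> t + L2 t * G \<gamma> (\<tau> t) - h \<gamma> t)"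
    unfolding solves_def by blast+
  note compare = delay_comparison[where \<tau> = \<tau> and ?L1.0 = L1 and ?L2.0 = L2 and T = T and r = r, OF T_pos tau_range L1_nonneg L2_nonneg small]
  have zero_in: "0 \<in> {-r..0}" using r_nonneg by simp

  have G_mono: "G \<gamma> t \<le> G \<gamma>' t"
    if \<gamma>: "\<gamma> \<in> ?I" "\<gamma>' \<in> ?I" and le: "\<And>s. s \<in> ?J \<Longrightarrow> \<gamma> s \<le> \<gamma>' s" and t: "t \<in> ?J" for \<gamma> \<gamma>' t
  proof (rule compare[OF _ _ _ GP[OF \<gamma>(1)] GP[OF \<gamma>(2)] _ _ _ _ _ t])
    have "AE t in Leb T. h \<gamma> t \<le> h \<gamma>' t" by (rule h_mono[OF \<gamma>]) (rule le)
    then show "AE t in Leb T. L1 t * G \<gamma>' t + L2 t * G \<gamma>' (\<tau> t) - h \<gamma>' t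
        - (L1 t * G \<gamma> t + L2 t * G \<gamma> (\<tau> t) - h \<gamma> t)
        \<le> L1 t * (G \<gamma>' t - G \<gamma> t) + L2 t * (G \<gamma>' (\<tau> t) - G \<gamma> (\<tau> t))"
      by eventually_elim (simp add: algebra_simps)
  qed (use zero_in in \<open>auto simp: G \<gamma>\<close>)

  \<comment> \<open>The lower and the upper solution are compared with their own images under \<open>G\<close>.\<close>
  obtain p\<alpha> where p\<alpha>: "has_second_deriv T \<alpha> p\<alpha> (weak_deriv2 T \<alpha>)"
    using W21_imp_has_second_deriv[OF T_pos \<alpha>(2) J0[OF \<alpha>(1)]] .
  have \<alpha>_le: "\<alpha> t \<le> G \<alpha> t" if t: "t \<in> ?J" for t
  proof (rule compare[OF _ _ _ p\<alpha> GP[OF \<alpha>I] _ _ _ _ _ t])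
    show "AE t in Leb T. L1 t * G \<alpha> t + L2 t * G \<alpha> (\<tau> t) - h \<alpha> t - weak_deriv2 T \<alpha> t
        \<le> L1 t * (G \<alpha> t - \<alpha> t) + L2 t * (G \<alpha> (\<tau> t) - \<alpha> (\<tau> t))"
      using \<alpha>(3) by eventually_elim (simp add: h_def F_def algebra_simps)
  qed (use zero_in \<alpha>(4-6) in \<open>auto simp: G \<alpha>I\<close>)
  obtain p\<beta> where p\<beta>: "has_second_deriv T \<beta> p\<beta> (weak_deriv2 T \<beta>)"
    using W21_imp_has_second_deriv[OF T_pos \<beta>(2) J0[OF \<beta>(1)]] .
  have le_\<beta>: "G \<beta> t \<le> \<beta> t" if t: "t \<in> ?J" for t
  proof (rule compare[OF _ _ _ GP[OF \<beta>I] p\<beta> _ _ _ _ _ t])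
    show "AE t in Leb T. weak_deriv2 T \<beta> t - (L1 t * G \<beta> t + L2 t * G \<beta> (\<tau> t) - h \<beta> t)
        \<le> L1 t * (\<beta> t - G \<beta> t) + L2 t * (\<beta> (\<tau> t) - G \<beta> (\<tau> t))"
      using \<beta>(3) by eventually_elim (simp add: h_def F_def algebra_simps)
  qed (use zero_in \<beta>(4-6) in \<open>auto simp: G \<beta>I\<close>)
  have G_in: "G \<gamma> \<in> ?I" if \<gamma>: "\<gamma> \<in> ?I" for \<gamma>
    unfolding fun_interval_def
  proof (intro CollectI conjI ballI G(1)[OF \<gamma>])
    fix t assume t: "t \<in> ?J"
    show "\<alpha> t \<le> G \<gamma> t"
      using \<alpha>_le[OF t] G_mono[OF \<alpha>I \<gamma> ID(2)[OF \<gamma>] t] by simp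
    show "G \<gamma> t \<le> \<beta> t"
      using le_\<beta>[OF t] G_mono[OF \<gamma> \<beta>I ID(3)[OF \<gamma>] t] by simp
  qed

  obtain C where C: "\<And>t. t \<in> ?J \<Longrightarrow> \<beta> t - \<alpha> t \<le> C"
  proof -
    have "continuous_on ?J (\<lambda>t. \<beta> t - \<alpha> t)" by (intro continuous_intros \<alpha>(1) \<beta>(1))
    then obtain x where "\<forall>t\<in>?J. \<beta> t - \<alpha> t \<le> \<beta> x - \<alpha> x"
      using continuous_attains_sup[of ?J "\<lambda>t. \<beta> t - \<alpha> t"] T_pos r_nonneg by auto
    then show ?thesis using that by blast
  qed
  \<comment> \<open>\<open>\<rho>\<close> bounds the second derivative of \<open>G \<gamma>\<close> uniformly in \<open>\<gamma>\<close>, because both \<open>\<gamma>\<close> and \<open>G \<gamma>\<close>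
      stay between \<open>\<alpha>\<close> and \<open>\<beta>\<close>.\<close>
  define \<rho> where "\<rho> t = \<psi> t + C * (L1 t + L2 t)" for t
  have i\<rho>: "integrable (Leb T) \<rho>" unfolding \<rho>_def using i\<psi> iL by simp
  define N where "N = \<bar>B - \<phi> 0\<bar> / T + integral {0..T} \<rho>"
  define \<omega> where "\<omega> s t = \<bar>\<phi> (min s 0) - \<phi> (min t 0)\<bar> + N * \<bar>s - t\<bar>" for s t
  have G_lipschitz: "\<bar>G \<gamma> s - G \<gamma> t\<bar> \<le> N * \<bar>s - t\<bar>"
    if \<gamma>: "\<gamma> \<in> ?I" and st: "s \<in> {0..T}" "t \<in> {0..T}" for \<gamma> s t
  proof -
    have "AE t in Leb T. \<bar>L1 t * G \<gamma> t + L2 t * G \<gamma> (\<tau> t) - h \<gamma> t\<bar> \<le> \<rho> t"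
      using F_bound[OF \<gamma>] AE_space
    proof eventually_elim
      case (elim t)
      then have t: "t \<in> {0..T}" by simp
      have gap: "\<bar>G \<gamma> s - \<gamma> s\<bar> \<le> C" if "s \<in> ?J" for s
        using C[OF that] ID(2,3)[OF \<gamma> that] ID(2,3)[OF G_in[OF \<gamma>] that] by linarith
      have "\<bar>L1 t * (G \<gamma> t - \<gamma> t)\<bar> \<le> L1 t * C"
        using L1_nonneg[OF t] gap[OF in_J(1)[OF t]] by (simp add: abs_mult mult_left_mono)
      moreover have "\<bar>L2 t * (G \<gamma> (\<tau> t) - \<gamma> (\<tau> t))\<bar> \<le> L2 t * C"
        using L2_nonneg[OF t] gap[OF in_J(2)[OF t]] by (simp add: abs_mult mult_left_mono)
      moreover have "L1 t * G \<gamma> t + L2 t * G \<gamma> (\<tau> t) - h \<gamma> t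
          = L1 t * (G \<gamma> t - \<gamma> t) + L2 t * (G \<gamma> (\<tau> t) - \<gamma> (\<tau> t)) - F \<gamma> t"
        by (simp add: h_def algebra_simps)
      moreover have "\<rho> t = \<psi> t + L1 t * C + L2 t * C" by (simp add: \<rho>_def algebra_simps)
      ultimately show ?case using elim(1) by linarith
    qed
    from second_deriv_bound_imp_lipschitz[OF T_pos GP[OF \<gamma>] i\<rho> this st]
    show ?thesis using G(2)[OF \<gamma> zero_in] G(3)[OF \<gamma>] by (simp add: N_def)
  qed
  have N0: "0 \<le> N"
    using order_trans[OF abs_ge_zero G_lipschitz[OF \<alpha>I, of 0 T]] T_pos
    by (simp add: zero_le_mult_iff)
  have G_equi: "\<bar>G \<gamma> s - G \<gamma> t\<bar> \<le> \<omega> s t"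
    if \<gamma>: "\<gamma> \<in> ?I" and st: "s \<in> ?J" "t \<in> ?J" for \<gamma> s t
  proof -
    have split: "G \<gamma> x = \<phi> (min x 0) + (G \<gamma> (max x 0) - \<phi> 0)" if "x \<in> ?J" for x
      using G(2)[OF \<gamma>, of x] G(2)[OF \<gamma> zero_in] that by (cases "x \<le> 0") auto
    have "\<bar>G \<gamma> (max s 0) - G \<gamma> (max t 0)\<bar> \<le> N * \<bar>max s 0 - max t 0\<bar>"
      using st T_pos by (intro G_lipschitz[OF \<gamma>]) auto
    also have "\<dots> \<le> N * \<bar>s - t\<bar>"
      using N0 by (intro mult_left_mono) auto
    finally show ?thesis using split[OF st(1)] split[OF st(2)] unfolding \<omega>_def by linarith
  qed
  have modulus: "continuous_on ?J u"
    if u: "\<And>s t. s \<in> ?J \<Longrightarrow> t \<in> ?J \<Longrightarrow> \<bar>u s - u t\<bar> \<le> \<omega> s t" for u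
    unfolding continuous_on_def
  proof
    fix t assume t: "t \<in> ?J"
    have "continuous_on ?J (\<lambda>s. \<phi> (min s 0))"
      by (rule continuous_on_compose2[OF phi_cont]) (use r_nonneg in \<open>auto intro!: continuous_intros\<close>)
    then have "continuous_on ?J (\<lambda>s. \<omega> s t)"
      unfolding \<omega>_def by (intro continuous_intros)
    then have "((\<lambda>s. \<omega> s t) \<longlongrightarrow> \<omega> t t) (at t within ?J)"
      using t unfolding continuous_on_def by (rule bspec)
    then have "((\<lambda>s. \<omega> s t) \<longlongrightarrow> 0) (at t within ?J)" by (simp add: \<omega>_def)
    then have "((\<lambda>s. u s - u t) \<longlongrightarrow> 0) (at t within ?J)"
      by (rule Lim_null_comparison[rotated])
        (use u t in \<open>auto simp: eventually_at_filter intro!: always_eventually\<close>)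
    then show "(u \<longlongrightarrow> u t) (at t within ?J)" by (simp add: LIM_zero_iff)
  qed

  \<comment> \<open>At a fixed point the added weights cancel, which leaves the original equation.\<close>
  have fixed_solves: "G u \<in> X_space r T \<inter> ?I \<and> is_solution r T \<phi> B \<tau> f (G u)"
    if u: "u \<in> ?I" and fx: "\<And>t. t \<in> ?J \<Longrightarrow> G u t = u t" for u
  proof -
    note W = has_second_deriv_imp_W21[OF T_pos GP[OF u]]
    have X: "G u \<in> X_space r T" using W(1) G(1)[OF u] by (simp add: X_space_def)
    have "AE t in Leb T. - weak_deriv2 T (G u) t = f t (G u t) (G u (\<tau> t))"
      using W(2) on_J by eventually_elim (simp add: fx h_def F_def)
    then show ?thesis
      using X G_in[OF u] G(2,3)[OF u] by (simp add: is_solution_def)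
  qed
  \<comment> \<open>A solution solves its own linear problem, and this problem has only one solution.\<close>
  have solution_fixed: "G w t = w t"
    if w: "w \<in> ?I" "is_solution r T \<phi> B \<tau> f w" and t: "t \<in> ?J" for w t
  proof -
    have sol: "w \<in> W21 T" "AE t in Leb T. - weak_deriv2 T w t = f t (w t) (w (\<tau> t))"
        "\<And>t. t \<in> {-r..0} \<Longrightarrow> w t = \<phi> t" "w T = B"
      using w(2) by (auto simp: is_solution_def X_space_def)
    obtain p where p: "has_second_deriv T w p (weak_deriv2 T w)"
      using W21_imp_has_second_deriv[OF T_pos sol(1) J0[OF ID(1)[OF w(1)]]] .
    have "w t \<le> G w t"
    proof (rule compare[OF _ _ _ p GP[OF w(1)] _ _ _ _ _ t])
      show "AE t in Leb T. L1 t * G w t + L2 t * G w (\<tau> t) - h w t - weak_deriv2 T w t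
          \<le> L1 t * (G w t - w t) + L2 t * (G w (\<tau> t) - w (\<tau> t))"
        using sol(2) by eventually_elim (simp add: h_def F_def algebra_simps)
    qed (use zero_in in \<open>auto simp: G w(1) sol\<close>)
    moreover have "G w t \<le> w t"
    proof (rule compare[OF _ _ _ GP[OF w(1)] p _ _ _ _ _ t])
      show "AE t in Leb T. weak_deriv2 T w t - (L1 t * G w t + L2 t * G w (\<tau> t) - h w t)
          \<le> L1 t * (w t - G w t) + L2 t * (w (\<tau> t) - G w (\<tau> t))"
        using sol(2) by eventually_elim (simp add: h_def F_def algebra_simps)
    qed (use zero_in in \<open>auto simp: G w(1) sol\<close>)
    ultimately show ?thesis by simp
  qed

  obtain u where u: "u \<in> ?I" "\<And>t. t \<in> ?J \<Longrightarrow> G u t = u t"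
    and u_least: "\<And>w t. w \<in> ?I \<Longrightarrow> (\<And>s. s \<in> ?J \<Longrightarrow> G w s = w s) \<Longrightarrow> t \<in> ?J \<Longrightarrow> u t \<le> w t"
    by (rule least_fixpoint_in_fun_interval[OF modulus G_in G_equi G_mono \<beta>I]) blast+
  obtain v where v: "v \<in> ?I" "\<And>t. t \<in> ?J \<Longrightarrow> G v t = v t"
    and v_greatest: "\<And>w t. w \<in> ?I \<Longrightarrow> (\<And>s. s \<in> ?J \<Longrightarrow> G w s = w s) \<Longrightarrow> t \<in> ?J \<Longrightarrow> w t \<le> v t"
    by (rule greatest_fixpoint_in_fun_interval[OF modulus G_in G_equi G_mono \<alpha>I]) blast+
  show ?thesis
  proof (intro exI conjI ballI impI)
    \<comment> \<open>\<open>u\<close> is controlled only on the interval, whereas \<open>G u\<close> has the classical derivatives of a solution.\<close>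
    show "G u \<in> X_space r T \<inter> ?I" "is_solution r T \<phi> B \<tau> f (G u)"
      using fixed_solves[OF u] by auto
    show "G v \<in> X_space r T \<inter> ?I" "is_solution r T \<phi> B \<tau> f (G v)"
      using fixed_solves[OF v] by auto
    fix w t assume w: "w \<in> X_space r T \<inter> ?I" "is_solution r T \<phi> B \<tau> f w" and t: "t \<in> ?J"
    then have wI: "w \<in> ?I" by simp
    show "G u t \<le> w t"
      using u_least[OF wI solution_fixed[OF wI w(2)] t] u(2)[OF t] by simp
    show "w t \<le> G v t"
      using v_greatest[OF wI solution_fixed[OF wI w(2)] t] v(2)[OF t] by simp
  qed
qed

end
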